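(* Let $H$ be a real Hilbert space, let $C\subset H$ be a nonempty closed $r$-prox-regular set with $r\in(0,+\infty]$, let $f:H\to H$ be $k$-Lipschitz continuous, and let $x_0\in C$. Let $x(\cdot)$ be the unique locally absolutely continuous solution on $[0,+\infty)$ of $\dot x(t)\in f(x(t))-N(C,x(t))$ for a.e. $t\in[0,+\infty)$, $x(0)=x_0$. Then: (i) $\dot{x}(t)=\big(f(x(t))-N(C,x(t))\big)^0$ for almost every $t\in[0,+\infty)$. (ii) For every $t^*\in[0,+\infty)$, the right derivative $\dot{x}^+(t^* )$ exists and $$\dot{x}^+(t^* )=\big(f(x(t^* ))-N(C,x(t^* ))\big)^0 .$$ Furthermore, the function $\dot{x}^+(\cdot):[0,+\infty)\to H$ is continuous on the right at every point of $[0,+\infty)$.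
   Context: For a closed set $C\subset H$ write $d(s,C)=\inf_{x\in C}\|s-x\|$ and $\mathrm{Proj}(C,s)=\{x\in C:\|s-x\|=d(s,C)\}$; when this set is a singleton its element is denoted $\mathrm{proj}(C,s)$. $C$ is called $r$-prox-regular if every point $s$ of $U_r(C)=\{w\in H: d(w,C)<r\}$ has a unique nearest point $\mathrm{proj}(C,s)$ in $C$ and the mapping $\mathrm{proj}(C,\cdot)$ is continuous on $U_r(C)$. The case $r=+\infty$ corresponds to $C$ convex. $N(C,x)=N_C(x)$ denotes the proximal normal cone of $C$ at $x\in C$: the set of all vectors $t(s-x)$ with $t\ge 0$, $s\in H$ and $x\in \mathrm{Proj}(C,s)$; $N(C,x)=\emptyset$ if $x\notin C$. (For prox-regular $C$ it coincides with the Fréchet, limiting and Clarke normal cones, and it is closed and convex.) For a closed convex nonempty set $D\subset H$, $D^0$ denotes its unique element of minimal norm. Under these assumptions it is known that for each $x_0\in C$ the differential inclusion has a unique locally absolutely continuous solution on $[0,+\infty)$. The right derivative is $\dot x^+(t)=\lim_{h\to0^+}\frac{x(t+h)-x(t)}{h}$ (limit in norm). *)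

theory Defs
  imports "HOL-Analysis.Analysis"
begin

definition Proj :: "'a::real_inner set \<Rightarrow> 'a \<Rightarrow> 'a set" where
  "Proj C s = {x \<in> C. norm (s - x) = infdist s C}"

text \<open>Only meaningful when \<open>Proj C s\<close> is a singleton.\<close>

definition proj :: "'a::real_inner set \<Rightarrow> 'a \<Rightarrow> 'a" where
  "proj C s = (THE x. x \<in> Proj C s)"

definition tube :: "ereal \<Rightarrow> 'a::real_inner set \<Rightarrow> 'a set" where
  "tube r C = {w. ereal (infdist w C) < r}"

text \<open>For \<open>r = \<infinity>\<close> the tube is the whole space. A nonempty closed subset of a Hilbert space
  with an everywhere defined, single-valued and continuous projection is convex, and conversely,
  so this case is the class of closed convex sets.\<close>

definition prox_regular :: "ereal \<Rightarrow> 'a::real_inner set \<Rightarrow> bool" where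
  "prox_regular r C \<longleftrightarrow>
     (\<forall>s \<in> tube r C. \<exists>!x. x \<in> Proj C s) \<and> continuous_on (tube r C) (proj C)"

text \<open>This is empty for \<open>x \<notin> C\<close>, since \<open>Proj C s \<subseteq> C\<close>.\<close>

definition prox_normal_cone :: "'a::real_inner set \<Rightarrow> 'a \<Rightarrow> 'a set" where
  "prox_normal_cone C x = {t *\<^sub>R (s - x) | t s. 0 \<le> t \<and> x \<in> Proj C s}"

text \<open>Only meaningful when the minimiser is unique, in particular for nonempty closed convex
  \<open>D\<close> in a Hilbert space.\<close>

definition min_norm :: "'a::real_inner set \<Rightarrow> 'a" where
  "min_norm D = (THE v. v \<in> D \<and> (\<forall>w \<in> D. norm v \<le> norm w))"

definition abs_continuous :: "real \<Rightarrow> real \<Rightarrow> (real \<Rightarrow> 'a::real_normed_vector) \<Rightarrow> bool" where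
  "abs_continuous a b x \<longleftrightarrow>
     (\<forall>\<epsilon>>0. \<exists>\<delta>>0. \<forall>(n::nat) u v.
        (\<forall>i<n. a \<le> u i \<and> u i \<le> v i \<and> v i \<le> b) \<and>
        disjoint_family_on (\<lambda>i. {u i<..<v i}) {..<n} \<and>
        (\<Sum>i<n. v i - u i) < \<delta>
        \<longrightarrow> (\<Sum>i<n. norm (x (v i) - x (u i))) < \<epsilon>)"

text \<open>Local absolute continuity on \<open>[0, \<infinity>)\<close>.
  Only the values of \<open>x\<close> at nonnegative times matter.\<close>

definition loc_abs_continuous :: "(real \<Rightarrow> 'a::real_normed_vector) \<Rightarrow> bool" where
  "loc_abs_continuous x \<longleftrightarrow> (\<forall>a b. 0 \<le> a \<and> a \<le> b \<longrightarrow> abs_continuous a b x)"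

definition velocities :: "('a \<Rightarrow> 'a) \<Rightarrow> 'a::real_inner set \<Rightarrow> 'a \<Rightarrow> 'a set" where
  "velocities f C y = (\<lambda>n. f y - n) ` prox_normal_cone C y"

definition is_solution ::
  "('a \<Rightarrow> 'a) \<Rightarrow> 'a::real_inner set \<Rightarrow> 'a \<Rightarrow> (real \<Rightarrow> 'a) \<Rightarrow> bool" where
  "is_solution f C x0 x \<longleftrightarrow>
     loc_abs_continuous x \<and> x 0 = x0 \<and>
     (AE t in lebesgue_on {0..}. \<exists>v \<in> velocities f C (x t).
        (x has_vector_derivative v) (at t within {0..}))"

definition has_right_deriv :: "(real \<Rightarrow> 'a::real_normed_vector) \<Rightarrow> 'a \<Rightarrow> real \<Rightarrow> bool" where
  "has_right_deriv x v t \<longleftrightarrow> ((\<lambda>h. (x (t + h) - x t) /\<^sub>R h) \<longlongrightarrow> v) (at_right 0)"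

definition right_deriv :: "(real \<Rightarrow> 'a::real_normed_vector) \<Rightarrow> real \<Rightarrow> 'a" where
  "right_deriv x t = (THE v. has_right_deriv x v t)"

end

theory Submission
  imports Defs
begin

text \<open>
  Four facts carry the proof.

  \<^item> \<^emph>\<open>Normals are uniformly proximal.\<close> For \<open>0 < \<rho> < r\<close> and \<open>\<xi>\<close> normal to \<open>C\<close> at \<open>x\<close>, every \<open>y \<in> C\<close>
    satisfies \<open>\<xi> \<bullet> (y - x) \<le> \<bar>\<xi>\<bar> / (2 * \<rho>) * \<bar>y - x\<bar>\<^sup>2\<close> (\<open>prox_normal_cone_inner_le\<close>). Conversely,
    a quadratic bound with any constant makes \<open>\<xi>\<close> a proximal normal. Hence the normal cone is
    closed and convex, and \<open>f - N\<close> is one-sided Lipschitz on pairs whose velocities and values of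
    \<open>f\<close> share a common bound. The constant cannot be read off the definition of a proximal normal,
    which only provides some ball touching \<open>C\<close> at \<open>x\<close>: one has to enlarge that ball to radius \<open>\<rho>\<close>.
    Continuity of the projection makes the distance function grow at unit rate off \<open>C\<close>, a
    maximality argument in the style of Ekeland turns this into growth by \<open>\<epsilon>\<close> on every ball of
    radius \<open>\<epsilon>\<close> inside the tube, and uniform convexity of the norm forces this growth to take place
    along the normal ray.
  \<^item> \<^emph>\<open>Elements of minimal norm are stable.\<close> Weak compactness is replaced by the fact that in a
    decreasing sequence of closed convex sets, almost minimal elements converge strongly
    (\<open>nested_convex_min_norm\<close>). Relaxing the quadratic inequalities that describe \<open>f(p) - N(C, p)\<close>
    by \<open>1 / n\<close> gives such a sequence, so that approximate velocities at \<open>p\<close> whose norms do not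
    exceed the minimal one in the limit converge to the velocity of minimal norm
    (\<open>tendsto_min_velocity\<close>).
  \<^item> \<^emph>\<open>Solutions stay in \<open>C\<close>.\<close> A two-sided derivative of a curve in \<open>C\<close> is therefore orthogonal to all
    normals, and Pythagoras shows that a velocity with this property has minimal norm. This is (i),
    and it bounds the speed of the solution by \<open>\<bar>f\<bar>\<close>, which makes the solution locally Lipschitz.
  \<^item> \<^emph>\<open>An absolutely continuous function grows at most as its almost everywhere derivative
    permits.\<close> With the one-sided Lipschitz estimate this yields the Gronwall bounds
    \<open>\<bar>x(s + h) - x(s)\<bar> \<le> exp(K * h) * \<bar>z\<bar> * h\<close>, where \<open>z\<close> is the velocity of minimal norm at \<open>x(s)\<close>,
    and \<open>\<bar>x(t + h) - x(t)\<bar> \<le> exp(K * (t - s)) * \<bar>x(s + h) - x(s)\<bar>\<close>.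

  The first Gronwall bound controls the norms of the difference quotients at \<open>s\<close>, and averaging the
  normal inequality over \<open>[s, s + h]\<close> shows that they are approximate velocities at \<open>x(s)\<close>; so they
  converge to \<open>z\<close>. Dividing the second bound by \<open>h\<close> shows that the minimal speed grows at most
  exponentially, and the same convergence argument applied to \<open>t \<mapsto> (f(x(t)) - N(C, x(t)))\<^sup>0\<close> gives right
  continuity.
\<close>

section \<open>Growth of the distance function off a prox-regular set\<close>

text \<open>
  The completeness argument behind Ekeland's variational principle: each point of a chosen sequence
  nearly maximises \<open>g\<close> over what lies above the previous one, so the sets of points above shrink to a
  single maximal point.
\<close>

lemma maximal_for_distance_order:
  fixes g :: "'a::complete_space \<Rightarrow> real"
  assumes S: "closed S" and g: "continuous_on S g" and bdd: "\<And>y. y \<in> S \<Longrightarrow> g y \<le> B"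
    and a: "a > 0" and s: "s \<in> S"
  obtains y where "y \<in> S" "g s + a * dist s y \<le> g y"
    "\<And>z. z \<in> S \<Longrightarrow> g y + a * dist y z \<le> g z \<Longrightarrow> z = y"
proof -
  define T where "T y = {z \<in> S. g y + a * dist y z \<le> g z}" for y
  have Trefl: "y \<in> T y" if "y \<in> S" for y
    using that by (auto simp: T_def)
  have Ttrans: "T z \<subseteq> T y" if "z \<in> T y" for y z
  proof
    fix w assume w: "w \<in> T z"
    have "a * dist y w \<le> a * dist y z + a * dist z w"
      using dist_triangle[of y w z] a by (metis distrib_left mult_le_cancel_left_pos)
    then show "w \<in> T y"
      using w that by (auto simp: T_def)
  qed
  have Tclosed: "closed (T y)" for y
  proof -
    have "continuous_on S (\<lambda>z. g z - (g y + a * dist y z))"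
      by (intro continuous_intros g)
    from continuous_closed_preimage[OF this S, of "{0..}"]
    show ?thesis by (simp add: T_def vimage_def Int_def)
  qed
  have bT: "bdd_above (g ` T y)" for y
    using bdd by (intro bdd_aboveI[of _ B]) (auto simp: T_def)
  have step: "\<exists>z\<in>T y. \<forall>w\<in>T y. g w \<le> g z + 1 / Suc n" if "y \<in> S" for y and n :: nat
  proof -
    have "Sup (g ` T y) - 1 / Suc n < Sup (g ` T y)" by simp
    then obtain z where z: "z \<in> T y" "Sup (g ` T y) - 1 / Suc n < g z"
      using less_cSup_iff[OF _ bT, of y "Sup (g ` T y) - 1 / Suc n"] Trefl[OF \<open>y \<in> S\<close>] by auto
    have "g w \<le> g z + 1 / Suc n" if "w \<in> T y" for w
      using cSup_upper[OF _ bT, of "g w" y] that z by auto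
    with z(1) show ?thesis by blast
  qed
  obtain q :: "nat \<Rightarrow> 'a" where q0: "q 0 = s" and qS: "\<And>n. q n \<in> S"
    and qT: "\<And>n::nat. q (Suc n) \<in> T (q n)"
    and qmax: "\<And>(n::nat) w. w \<in> T (q n) \<Longrightarrow> g w \<le> g (q (Suc n)) + 1 / Suc n"
  proof -
    have "\<exists>q. q 0 = s \<and> (\<forall>n. q n \<in> S \<and> (q (Suc n) \<in> T (q n) \<and>
        (\<forall>w\<in>T (q n). g w \<le> g (q (Suc n)) + 1 / Suc n)))"
    proof -
      have "\<exists>q. \<forall>n. (q n \<in> S \<and> (n = 0 \<longrightarrow> q n = s)) \<and> (q (Suc n) \<in> T (q n) \<and>
        (\<forall>w\<in>T (q n). g w \<le> g (q (Suc n)) + 1 / Suc n))"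
      proof (rule dependent_nat_choice)
        show "\<exists>x. x \<in> S \<and> ((0::nat) = 0 \<longrightarrow> x = s)" using s by auto
      next
        fix y and n :: nat assume "y \<in> S \<and> (n = 0 \<longrightarrow> y = s)"
        then obtain z where z: "z \<in> T y" "\<forall>w\<in>T y. g w \<le> g z + 1 / Suc n"
          using step[of y n] by blast
        then show "\<exists>z. (z \<in> S \<and> (Suc n = 0 \<longrightarrow> z = s)) \<and>
            (z \<in> T y \<and> (\<forall>w\<in>T y. g w \<le> g z + 1 / Suc n))"
          by (intro exI[of _ z]) (auto simp: T_def)
      qed
      then obtain q where "\<forall>n. (q n \<in> S \<and> (n = 0 \<longrightarrow> q n = s)) \<and> (q (Suc n) \<in> T (q n) \<and>
        (\<forall>w\<in>T (q n). g w \<le> g (q (Suc n)) + 1 / Suc n))" by blast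
      then show ?thesis by (intro exI[of _ q]) auto
    qed
    then show ?thesis using that by blast
  qed
  have close: "a * dist (q (Suc n)) w \<le> 1 / Suc n" if "w \<in> T (q (Suc n))" for w n
  proof -
    have "w \<in> T (q n)" using that Ttrans[OF qT] by blast
    with qmax have "g w \<le> g (q (Suc n)) + 1 / Suc n" by blast
    with that show ?thesis by (auto simp: T_def)
  qed
  have "\<exists>y. \<Inter>(range (\<lambda>n. T (q n))) = {y}"
  proof (rule decreasing_closed_nest_sing)
    show "T (q n) \<noteq> {}" for n using Trefl[OF qS] by blast
    show "T (q n) \<subseteq> T (q m)" if "m \<le> n" for m n
      using that by (induction rule: dec_induct) (use Ttrans[OF qT] in blast)+
    show "\<exists>n. \<forall>x\<in>T (q n). \<forall>y\<in>T (q n). dist x y < e" if e: "e > 0" for e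
    proof -
      obtain n where n: "inverse (real (Suc n)) < a * e / 2"
        using reals_Archimedean[of "a * e / 2"] half_gt_zero[OF mult_pos_pos[OF a e]] by blast
      have "dist x y < e" if "x \<in> T (q (Suc n))" "y \<in> T (q (Suc n))" for x y
      proof -
        have "a * dist x y \<le> a * dist (q (Suc n)) x + a * dist (q (Suc n)) y"
          using dist_triangle3[of x y "q (Suc n)"] a
          by (metis distrib_left mult_le_cancel_left_pos)
        also have "\<dots> < a * e"
          using close[OF that(1)] close[OF that(2)] n by (simp add: inverse_eq_divide)
        finally show ?thesis using a by simp
      qed
      then show ?thesis by blast
    qed
  qed (use Tclosed in auto)
  then obtain y where y: "\<Inter>(range (\<lambda>n. T (q n))) = {y}" by blast
  then have yT: "y \<in> T (q n)" for n by blast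
  show ?thesis
  proof
    show "y \<in> S" "g s + a * dist s y \<le> g y" using yT[of 0] q0 by (auto simp: T_def)
    show "z = y" if "z \<in> S" "g y + a * dist y z \<le> g z" for z
    proof -
      have "z \<in> T y" using that by (simp add: T_def)
      then have "z \<in> T (q n)" for n using Ttrans[OF yT] by blast
      then show ?thesis using y by blast
    qed
  qed
qed

lemma norm_plus_scaleR_power2:
  fixes b u :: "'a::real_inner"
  shows "(norm (b + h *\<^sub>R u))\<^sup>2 = (norm b)\<^sup>2 + 2 * h * (b \<bullet> u) + h\<^sup>2 * (norm u)\<^sup>2"
  unfolding power2_norm_eq_inner
  by (simp add: inner_add inner_commute power2_eq_square algebra_simps)

lemma proj_in_Proj:
  assumes "prox_regular r C" "s \<in> tube r C"
  shows "proj C s \<in> Proj C s"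
proof -
  have "\<exists>!x. x \<in> Proj C s" using assms by (simp add: prox_regular_def)
  then show ?thesis unfolding proj_def by (rule theI')
qed

text \<open>
  A small step \<open>h\<close> from \<open>s\<close> away from its projection increases the distance by almost \<open>h\<close>. Compare both
  distances through the projection \<open>p'\<close> of the new point, which is also a competitor for \<open>s\<close>:
  the gain is governed by the direction \<open>s - p'\<close>, and continuity of the projection keeps \<open>p'\<close>
  close to the projection of \<open>s\<close>.
\<close>

lemma infdist_increases_along_normal:
  fixes C :: "'a::real_inner set"
  assumes pr: "prox_regular r C" and s: "s \<in> tube r C" and d: "infdist s C > 0"
    and \<delta>: "0 < \<delta>" "\<delta> < 1" and \<eta>: "0 < \<eta>"
  obtains y where "y \<noteq> s" "dist s y < \<eta>" "infdist s C + (1 - \<delta>) * dist s y \<le> infdist y C"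
proof -
  define p where "p = proj C s"
  define d where "d = infdist s C"
  define u where "u = (s - p) /\<^sub>R d"
  have d0: "d > 0" using d by (simp add: d_def)
  have p: "p \<in> C" "norm (s - p) = d"
    using proj_in_Proj[OF pr s] by (auto simp: Proj_def p_def d_def)
  have u: "norm u = 1" "u \<bullet> (s - p) = d"
    using p d0 by (auto simp: u_def dot_square_norm power2_eq_square)
  have d_line: "infdist (s + h *\<^sub>R u) C \<le> d + \<bar>h\<bar>" for h
    using infdist_triangle[of "s + h *\<^sub>R u" C s] u by (simp add: d_def dist_norm)
  obtain \<rho> where \<rho>: "\<rho> > 0" "\<And>h. \<bar>h\<bar> < \<rho> \<Longrightarrow> s + h *\<^sub>R u \<in> tube r C"
  proof -
    have "ereal d < r" using s by (simp add: tube_def d_def)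
    then obtain z where z: "ereal d < ereal z" "ereal z < r"
      using ereal_dense2[of "ereal d" r] by blast
    show ?thesis
    proof
      show "z - d > 0" using z by simp
      fix h assume "\<bar>h\<bar> < z - d"
      with d_line[of h] have "ereal (infdist (s + h *\<^sub>R u) C) \<le> ereal z" by simp
      also note z(2)
      finally show "s + h *\<^sub>R u \<in> tube r C" by (simp add: tube_def)
    qed
  qed
  have "((\<lambda>h. proj C (s + h *\<^sub>R u)) \<longlongrightarrow> p) (at_right 0)"
  proof -
    have "continuous_on {-\<rho><..<\<rho>} (\<lambda>h. proj C (s + h *\<^sub>R u))"
      using pr \<rho>(2) unfolding prox_regular_def
      by (auto intro!: continuous_on_compose2[of "tube r C" "proj C"] continuous_intros)
    then have "isCont (\<lambda>h. proj C (s + h *\<^sub>R u)) 0"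
      using \<rho>(1) by (subst (asm) continuous_on_eq_continuous_at) auto
    then have "((\<lambda>h. proj C (s + h *\<^sub>R u)) \<longlongrightarrow> p) (at 0)"
      by (simp add: isCont_def p_def)
    then show ?thesis by (rule tendsto_mono[OF at_le, rotated]) simp
  qed
  then have "((\<lambda>h. u \<bullet> (s - proj C (s + h *\<^sub>R u))) \<longlongrightarrow> u \<bullet> (s - p)) (at_right 0)"
    by (intro tendsto_intros)
  then have "eventually (\<lambda>h. u \<bullet> (s - proj C (s + h *\<^sub>R u)) > (1 - \<delta>) * d) (at_right 0)"
    using d0 \<delta> u by (intro order_tendstoD(1)) auto
  moreover have "eventually (\<lambda>h. h < min \<rho> \<eta>) (at_right (0::real))"
    using \<rho>(1) \<eta> by (intro eventually_at_rightI[of 0 "min \<rho> \<eta>"]) auto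
  moreover have "eventually (\<lambda>h. h > 0) (at_right (0::real))"
    by (simp add: eventually_at_right_less)
  ultimately have "eventually (\<lambda>h. u \<bullet> (s - proj C (s + h *\<^sub>R u)) > (1 - \<delta>) * d \<and>
      h < min \<rho> \<eta> \<and> h > 0) (at_right 0)"
    by eventually_elim auto
  then obtain h where h: "u \<bullet> (s - proj C (s + h *\<^sub>R u)) > (1 - \<delta>) * d" "h < \<rho>" "h < \<eta>" "h > 0"
    using eventually_happens[of _ "at_right (0::real)"] by auto
  define y where "y = s + h *\<^sub>R u"
  define p' where "p' = proj C y"
  have p': "p' \<in> C" "norm (y - p') = infdist y C"
    using proj_in_Proj[OF pr \<rho>(2)[of h]] h by (auto simp: Proj_def p'_def y_def)
  have sy: "dist s y = h" using h u by (simp add: y_def dist_norm)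
  show ?thesis
  proof
    show "y \<noteq> s" "dist s y < \<eta>" using sy h by auto
    have "(norm (y - p'))\<^sup>2 = (norm (s - p'))\<^sup>2 + 2 * h * (u \<bullet> (s - p')) + h\<^sup>2"
      using norm_plus_scaleR_power2[of "s - p'" h u] u by (simp add: y_def inner_commute algebra_simps)
    moreover have "d\<^sup>2 \<le> (norm (s - p'))\<^sup>2"
      using infdist_le[OF p'(1), of s] d0 by (intro power_mono) (auto simp: d_def dist_norm)
    moreover have "2 * h * ((1 - \<delta>) * d) \<le> 2 * h * (u \<bullet> (s - p'))"
      using h by (auto simp: p'_def y_def)
    moreover have "((1 - \<delta>) * h)\<^sup>2 \<le> h\<^sup>2"
      using \<delta> h by (intro power_mono) (auto simp: mult_le_cancel_right1)
    moreover have "(d + (1 - \<delta>) * h)\<^sup>2 = d\<^sup>2 + 2 * h * ((1 - \<delta>) * d) + ((1 - \<delta>) * h)\<^sup>2"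
      by (simp add: power2_eq_square algebra_simps)
    ultimately have "(d + (1 - \<delta>) * h)\<^sup>2 \<le> (norm (y - p'))\<^sup>2"
      by linarith
    then show "infdist s C + (1 - \<delta>) * dist s y \<le> infdist y C"
      using p' sy by (metis d_def norm_ge_zero power2_le_imp_le)
  qed
qed

text \<open>
  A maximal point of the distance function on the ball of radius \<open>\<epsilon>\<close> around \<open>s\<close> lies on its boundary,
  since otherwise the distance could still grow; so the ball contains points at distance almost
  \<open>infdist s C + \<epsilon>\<close>. They have at least this distance from \<open>p\<close> as well, and in an inner
  product space the points of the ball that are so far from \<open>p\<close> all lie near its farthest point.
\<close>

lemma infdist_along_normal:
  fixes C :: "'a::{real_inner, complete_space} set"
  assumes pr: "prox_regular r C" and s: "infdist s C > 0" and p: "p \<in> Proj C s"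
    and \<epsilon>: "0 < \<epsilon>" "ereal (infdist s C + \<epsilon>) < r"
  shows "infdist s C + \<epsilon> \<le> infdist (s + (\<epsilon> / infdist s C) *\<^sub>R (s - p)) C"
proof -
  define d where "d = infdist s C"
  define u where "u = (s - p) /\<^sub>R d"
  define w where "w = s + \<epsilon> *\<^sub>R u"
  have d0: "d > 0" using s by (simp add: d_def)
  have pC: "p \<in> C" "norm (s - p) = d" using p by (auto simp: Proj_def d_def)
  have u: "norm u = 1" "s - p = d *\<^sub>R u" using pC d0 by (auto simp: u_def)
  have "\<exists>y. dist s y \<le> \<epsilon> \<and> d + (1 - \<delta>) * \<epsilon> \<le> infdist y C" if \<delta>: "0 < \<delta>" "\<delta> < 1" for \<delta>
  proof -
    have bound: "infdist y C \<le> d + \<epsilon>" if "y \<in> cball s \<epsilon>" for y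
      using infdist_triangle[of y C s] that by (auto simp: d_def dist_commute)
    obtain y where y: "y \<in> cball s \<epsilon>" "d + (1 - \<delta>) * dist s y \<le> infdist y C"
      and max: "\<And>z. z \<in> cball s \<epsilon> \<Longrightarrow> infdist y C + (1 - \<delta>) * dist y z \<le> infdist z C \<Longrightarrow> z = y"
    proof (rule maximal_for_distance_order[of "cball s \<epsilon>" "\<lambda>y. infdist y C" "d + \<epsilon>" "1 - \<delta>" s])
      show "continuous_on (cball s \<epsilon>) (\<lambda>y. infdist y C)" by (intro continuous_intros)
    qed (use bound \<delta> \<epsilon> d_def in auto)
    have "dist s y = \<epsilon>"
    proof (rule ccontr)
      assume "dist s y \<noteq> \<epsilon>"
      then have lt: "0 < \<epsilon> - dist s y" using y by simp
      have "infdist y C > 0" using y(2) \<delta> d0 by (smt (verit) mult_nonneg_nonneg zero_le_dist)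
      moreover have "y \<in> tube r C"
        using bound[OF y(1)] \<epsilon>(2) order_le_less_trans[of "ereal (infdist y C)" "ereal (d + \<epsilon>)" r]
        by (simp add: tube_def d_def)
      ultimately obtain z where z: "z \<noteq> y" "dist y z < \<epsilon> - dist s y"
        "infdist y C + (1 - \<delta>) * dist y z \<le> infdist z C"
        using infdist_increases_along_normal[OF pr _ _ \<delta> lt] by blast
      have "z \<in> cball s \<epsilon>" using z(2) dist_triangle[of s z y] by auto
      with max z show False by blast
    qed
    then show ?thesis using y by auto
  qed
  \<comment> \<open>The offset \<open>2\<close> keeps \<open>\<delta>\<close> strictly below \<open>1\<close>.\<close>
  then have "\<exists>y. dist s y \<le> \<epsilon> \<and> d + (1 - 1 / real (n + 2)) * \<epsilon> \<le> infdist y C" for n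
    by auto
  then obtain q where q: "\<And>n. dist s (q n) \<le> \<epsilon>"
    "\<And>n. d + (1 - 1 / real (n + 2)) * \<epsilon> \<le> infdist (q n) C" by metis
  have dist0: "(\<lambda>n. 1 / real (n + 2)) \<longlonglongrightarrow> 0"
    using LIMSEQ_ignore_initial_segment[OF lim_1_over_n[where 'a=real], of 2] by simp
  have near: "(norm (q n - w))\<^sup>2 \<le> (2 * \<epsilon>\<^sup>2 + 2 * \<epsilon>^3 / d) * (1 / real (n + 2))" for n
  proof -
    define \<delta> where "\<delta> = 1 / real (n + 2)"
    have \<delta>: "0 < \<delta>" "\<delta> < 1" by (auto simp: \<delta>_def)
    define b where "b = q n - s"
    have b: "norm b \<le> \<epsilon>" using q(1)[of n] by (simp add: b_def dist_norm norm_minus_commute)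
    have "d + (1 - \<delta>) * \<epsilon> \<le> norm (b + d *\<^sub>R u)"
      using q(2)[of n] infdist_le[OF pC(1), of "q n"] u(2) by (simp add: b_def dist_norm \<delta>_def flip: u(2))
    then have "(d + (1 - \<delta>) * \<epsilon>)\<^sup>2 \<le> (norm (b + d *\<^sub>R u))\<^sup>2"
      using d0 \<delta> \<epsilon> by (intro power_mono) auto
    moreover have "(norm (b + d *\<^sub>R u))\<^sup>2 = (norm b)\<^sup>2 + 2 * d * (b \<bullet> u) + d\<^sup>2"
      using norm_plus_scaleR_power2[of b d u] u by simp
    moreover have b2: "(norm b)\<^sup>2 \<le> \<epsilon>\<^sup>2" using b by (intro power_mono) auto
    moreover have "(d + (1 - \<delta>) * \<epsilon>)\<^sup>2 = d\<^sup>2 + 2 * d * ((1 - \<delta>) * \<epsilon>) + (((1 - \<delta>)\<^sup>2 - 1) * \<epsilon>\<^sup>2 + \<epsilon>\<^sup>2)"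
      by (simp add: power2_eq_square algebra_simps)
    ultimately have "2 * d * (b \<bullet> u) \<ge> 2 * d * ((1 - \<delta>) * \<epsilon>) + ((1 - \<delta>)\<^sup>2 - 1) * \<epsilon>\<^sup>2"
      by linarith
    moreover have "((1 - \<delta>)\<^sup>2 - 1) * \<epsilon>\<^sup>2 \<ge> - (2 * \<delta>) * \<epsilon>\<^sup>2"
      by (intro mult_right_mono) (auto simp: power2_eq_square algebra_simps)
    ultimately have "2 * d * (b \<bullet> u) \<ge> 2 * d * ((1 - \<delta>) * \<epsilon> - \<delta> * \<epsilon>\<^sup>2 / d)"
      using d0 by (simp add: algebra_simps)
    then have bu: "b \<bullet> u \<ge> (1 - \<delta>) * \<epsilon> - \<delta> * \<epsilon>\<^sup>2 / d"
      using d0 by (subst (asm) mult_le_cancel_left_pos) auto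
    have "q n - w = b - \<epsilon> *\<^sub>R u" by (simp add: b_def w_def)
    then have "(norm (q n - w))\<^sup>2 = (norm b)\<^sup>2 - 2 * \<epsilon> * (b \<bullet> u) + \<epsilon>\<^sup>2"
      using norm_plus_scaleR_power2[of b "-\<epsilon>" u] u by simp
    also have "\<dots> \<le> 2 * \<epsilon>\<^sup>2 - 2 * \<epsilon> * ((1 - \<delta>) * \<epsilon> - \<delta> * \<epsilon>\<^sup>2 / d)"
    proof -
      have "2 * \<epsilon> * ((1 - \<delta>) * \<epsilon> - \<delta> * \<epsilon>\<^sup>2 / d) \<le> 2 * \<epsilon> * (b \<bullet> u)"
        using bu \<epsilon> by (intro mult_left_mono) auto
      with b2 show ?thesis by linarith
    qed
    also have "\<dots> = (2 * \<epsilon>\<^sup>2 + 2 * \<epsilon>^3 / d) * \<delta>"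
      by (simp add: power2_eq_square power3_eq_cube algebra_simps)
    finally show ?thesis by (simp add: \<delta>_def)
  qed
  have "(\<lambda>n. (norm (q n - w))\<^sup>2) \<longlonglongrightarrow> 0"
  proof (rule tendsto_sandwich[OF _ _ tendsto_const])
    show "(\<lambda>n. (2 * \<epsilon>\<^sup>2 + 2 * \<epsilon>^3 / d) * (1 / real (n + 2))) \<longlonglongrightarrow> 0"
      using tendsto_mult_left[OF dist0, of "2 * \<epsilon>\<^sup>2 + 2 * \<epsilon>^3 / d"] by simp
  qed (use near in auto)
  then have "(\<lambda>n. norm (q n - w)) \<longlonglongrightarrow> 0"
    using tendsto_real_sqrt by fastforce
  then have "q \<longlonglongrightarrow> w" by (simp add: tendsto_norm_zero_iff LIM_zero_iff)
  then have "(\<lambda>n. infdist (q n) C) \<longlonglongrightarrow> infdist w C" by (rule tendsto_infdist)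
  moreover have "(\<lambda>n. d + (1 - 1 / real (n + 2)) * \<epsilon>) \<longlonglongrightarrow> d + (1 - 0) * \<epsilon>"
    by (intro tendsto_intros dist0)
  ultimately have "d + \<epsilon> \<le> infdist w C"
    using q(2) LIMSEQ_le[of "\<lambda>n. d + (1 - 1 / real (n + 2)) * \<epsilon>"] by force
  then show ?thesis by (simp add: w_def u_def d_def divide_inverse)
qed

section \<open>Proximal normal cones and velocity sets\<close>

text \<open>
  The ball of radius \<open>\<rho>\<close> that touches \<open>C\<close> at \<open>x\<close> from the direction \<open>\<xi>\<close> contains no point of \<open>C\<close> in its
  interior. If the ball given by the definition of \<open>\<xi>\<close> is larger, the triangle inequality suffices;
  if it is smaller, it is enlarged by following the distance function along the ray.
\<close>

lemma prox_normal_cone_inner_le: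
  fixes C :: "'a::{real_inner, complete_space} set"
  assumes pr: "prox_regular r C" and \<rho>: "0 < \<rho>" "ereal \<rho> < r"
    and \<xi>: "\<xi> \<in> prox_normal_cone C x" and y: "y \<in> C"
  shows "\<xi> \<bullet> (y - x) \<le> norm \<xi> / (2 * \<rho>) * (norm (y - x))\<^sup>2"
proof (cases "\<xi> = 0")
  case False
  obtain t s where ts: "\<xi> = t *\<^sub>R (s - x)" "0 \<le> t" "x \<in> Proj C s"
    using \<xi> by (auto simp: prox_normal_cone_def)
  have t: "t > 0" and sx: "s \<noteq> x" using ts False by auto
  define d where "d = norm (s - x)"
  define u where "u = (s - x) /\<^sub>R d"
  have d: "d > 0" using sx by (simp add: d_def)
  have u: "norm u = 1" "s - x = d *\<^sub>R u" using d by (auto simp: u_def d_def)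
  have xC: "x \<in> C" and dist_s: "infdist s C = d"
    using ts(3) by (auto simp: Proj_def d_def)
  have far: "\<rho> \<le> norm (x + \<rho> *\<^sub>R u - y)"
  proof (cases "d < \<rho>")
    case True
    have "d + (\<rho> - d) \<le> infdist (s + ((\<rho> - d) / d) *\<^sub>R (s - x)) C"
      using infdist_along_normal[OF pr _ ts(3), of "\<rho> - d"] True d \<rho> dist_s by simp
    also have "s + ((\<rho> - d) / d) *\<^sub>R (s - x) = x + d *\<^sub>R u + ((\<rho> - d) / d * d) *\<^sub>R u"
      using u(2) by (metis add.commute diff_add_cancel scaleR_scaleR)
    also have "\<dots> = x + \<rho> *\<^sub>R u" using d by (simp add: scaleR_diff_left)
    also have "infdist (x + \<rho> *\<^sub>R u) C \<le> norm (x + \<rho> *\<^sub>R u - y)"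
      using infdist_le[OF y] by (simp add: dist_norm)
    finally show ?thesis by simp
  next
    case False
    have "d \<le> norm (s - y)" using infdist_le[OF y, of s] dist_s by (simp add: dist_norm)
    also have "s - y = (x + \<rho> *\<^sub>R u - y) + (d - \<rho>) *\<^sub>R u"
      using u(2) by (simp add: algebra_simps)
    also have "norm \<dots> \<le> norm (x + \<rho> *\<^sub>R u - y) + (d - \<rho>)"
      using norm_triangle_ineq[of "x + \<rho> *\<^sub>R u - y" "(d - \<rho>) *\<^sub>R u"] u(1) False by simp
    finally show ?thesis by simp
  qed
  have "\<rho>\<^sup>2 \<le> (norm ((x - y) + \<rho> *\<^sub>R u))\<^sup>2"
    using far \<rho> by (intro power_mono) (auto simp: algebra_simps)
  then have "2 * \<rho> * (u \<bullet> (y - x)) \<le> (norm (y - x))\<^sup>2"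
    unfolding norm_plus_scaleR_power2
    using u(1) by (simp add: norm_minus_commute[of x y] inner_diff inner_commute algebra_simps)
  then have "u \<bullet> (y - x) \<le> (norm (y - x))\<^sup>2 / (2 * \<rho>)"
    using \<rho> by (simp add: field_simps)
  then have "norm \<xi> * (u \<bullet> (y - x)) \<le> norm \<xi> * ((norm (y - x))\<^sup>2 / (2 * \<rho>))"
    by (intro mult_left_mono) auto
  moreover have "\<xi> = norm \<xi> *\<^sub>R u"
    using ts(1,2) u d by simp
  ultimately show ?thesis by (metis inner_scaleR_left times_divide_eq_left times_divide_eq_right)
qed (use \<rho> in simp)

text \<open>
  Given a quadratic upper bound with any constant, a short enough step from \<open>x\<close> in direction \<open>\<xi>\<close> leads
  to a point that still has \<open>x\<close> as a nearest point.
\<close>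

lemma prox_normal_coneI:
  assumes "x \<in> C" and le: "\<And>y. y \<in> C \<Longrightarrow> \<xi> \<bullet> (y - x) \<le> \<sigma> * (norm (y - x))\<^sup>2"
  shows "\<xi> \<in> prox_normal_cone C x"
proof -
  \<comment> \<open>The reciprocal of the step length. It has to be at least \<open>2 * \<sigma>\<close> for \<open>x\<close> to be nearest, and the maximum makes it positive.\<close>
  define \<tau> where "\<tau> = 2 * max \<sigma> 1"
  have \<tau>: "\<tau> > 0" "2 * \<sigma> \<le> \<tau>" by (auto simp: \<tau>_def)
  define s where "s = x + \<xi> /\<^sub>R \<tau>"
  have "norm (s - x) \<le> dist s y" if y: "y \<in> C" for y
  proof -
    have "2 * (\<xi> \<bullet> (y - x)) \<le> \<tau> * (norm (y - x))\<^sup>2"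
      using le[OF y] mult_right_mono[OF \<tau>(2), of "(norm (y - x))\<^sup>2"] by simp
    then have *: "2 * inverse \<tau> * ((y - x) \<bullet> \<xi>) \<le> (norm (y - x))\<^sup>2"
      using \<tau>(1) by (simp add: field_simps inner_commute)
    have "(norm ((y - x) + (- inverse \<tau>) *\<^sub>R \<xi>))\<^sup>2 =
        (norm (y - x))\<^sup>2 - 2 * inverse \<tau> * ((y - x) \<bullet> \<xi>) + (norm (s - x))\<^sup>2"
      unfolding norm_plus_scaleR_power2 using \<tau> by (simp add: s_def power_mult_distrib)
    also have "(y - x) + (- inverse \<tau>) *\<^sub>R \<xi> = - (s - y)" by (simp add: s_def)
    finally have "(norm (s - x))\<^sup>2 \<le> (norm (s - y))\<^sup>2" using * unfolding norm_minus_cancel by linarith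
    then show ?thesis by (simp add: dist_norm)
  qed
  then have "norm (s - x) \<le> infdist s C"
    using \<open>x \<in> C\<close> by (auto simp: infdist_def intro!: cINF_greatest)
  moreover have "infdist s C \<le> norm (s - x)"
    using infdist_le[OF \<open>x \<in> C\<close>, of s] by (simp add: dist_norm)
  ultimately have "x \<in> Proj C s" using \<open>x \<in> C\<close> by (simp add: Proj_def)
  moreover have "\<xi> = \<tau> *\<^sub>R (s - x)" using \<tau> by (simp add: s_def)
  ultimately show ?thesis
    using \<tau> unfolding prox_normal_cone_def by (intro CollectI exI[of _ \<tau>] exI[of _ s]) auto
qed

lemma in_prox_normal_coneD: "\<xi> \<in> prox_normal_cone C x \<Longrightarrow> x \<in> C"
  by (auto simp: prox_normal_cone_def Proj_def)

lemma zero_in_prox_normal_cone: "x \<in> C \<Longrightarrow> 0 \<in> prox_normal_cone C x"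
  by (rule prox_normal_coneI[where \<sigma>=0]) auto

text \<open>
  Both directions combined describe the cone by inequalities with a constant that is proportional to
  \<open>norm \<xi>\<close>. These are closed conditions.
\<close>

lemma closed_prox_normal_cone:
  fixes C :: "'a::{real_inner, complete_space} set"
  assumes "prox_regular r C" and "0 < \<rho>" "ereal \<rho> < r" and x: "x \<in> C"
  shows "closed (prox_normal_cone C x)"
proof -
  have "prox_normal_cone C x =
      (\<Inter>y\<in>C. {\<xi>. \<xi> \<bullet> (y - x) \<le> norm \<xi> / (2 * \<rho>) * (norm (y - x))\<^sup>2})"
    using prox_normal_cone_inner_le[OF assms(1-3)] prox_normal_coneI[OF x]
    by (fastforce simp: set_eq_iff)
  moreover have "closed {\<xi>. \<xi> \<bullet> (y - x) \<le> norm \<xi> / (2 * \<rho>) * (norm (y - x))\<^sup>2}" for y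
    using \<open>0 < \<rho>\<close> by (intro closed_Collect_le continuous_intros) auto
  ultimately show ?thesis by auto
qed

text \<open>
  The inequality with \<open>norm \<xi>\<close> on the right-hand side is not convex in \<open>\<xi>\<close>, but a convex combination
  of normals satisfies it with the combined constant, which is enough.
\<close>

lemma convex_prox_normal_cone:
  fixes C :: "'a::{real_inner, complete_space} set"
  assumes "prox_regular r C" and "0 < \<rho>" "ereal \<rho> < r" and x: "x \<in> C"
  shows "convex (prox_normal_cone C x)"
proof (rule convexI)
  fix \<xi> \<eta> and a b :: real
  assume \<xi>: "\<xi> \<in> prox_normal_cone C x" and \<eta>: "\<eta> \<in> prox_normal_cone C x"
    and ab: "0 \<le> a" "0 \<le> b" "a + b = 1"
  show "a *\<^sub>R \<xi> + b *\<^sub>R \<eta> \<in> prox_normal_cone C x"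
  proof (rule prox_normal_coneI[OF x])
    fix y assume y: "y \<in> C"
    note le = prox_normal_cone_inner_le[OF assms(1-3) _ y]
    show "(a *\<^sub>R \<xi> + b *\<^sub>R \<eta>) \<bullet> (y - x)
        \<le> (a * (norm \<xi> / (2 * \<rho>)) + b * (norm \<eta> / (2 * \<rho>))) * (norm (y - x))\<^sup>2"
      using mult_left_mono[OF le[OF \<xi>] ab(1)] mult_left_mono[OF le[OF \<eta>] ab(2)]
      by (simp add: inner_add_left distrib_right mult.assoc)
  qed
qed

lemma velocities_closed_convex:
  fixes C :: "'a::{real_inner, complete_space} set"
  assumes "prox_regular r C" and "0 < \<rho>" "ereal \<rho> < r" and "y \<in> C"
  shows "closed (velocities f C y)" "convex (velocities f C y)" "f y \<in> velocities f C y"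
proof -
  have eq: "velocities f C y = (+) (f y) ` uminus ` prox_normal_cone C y"
    by (auto simp: velocities_def image_image)
  show "closed (velocities f C y)" "convex (velocities f C y)"
    unfolding eq using closed_prox_normal_cone[OF assms] convex_prox_normal_cone[OF assms]
    by (auto intro: closed_translation convex_translation closed_negations convex_negations)
  show "f y \<in> velocities f C y"
    using zero_in_prox_normal_cone[OF assms(4)] by (force simp: velocities_def)
qed

section \<open>Elements of minimal norm\<close>

text \<open>
  This replaces weak compactness and weak lower semicontinuity of the norm. The minimal norms \<open>\<mu> n\<close>
  of the sets increase to a limit \<open>L\<close>. Midpoints of elements of \<open>D n\<close> have norm at least \<open>\<mu> n\<close>, so by the
  parallelogram law the parts of \<open>D n\<close> of norm at most \<open>L + 1 / Suc n\<close> have diameters tending to \<open>0\<close>.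
  The second conclusion gives more than an element of the intersection: almost minimal elements of
  the sets converge strongly to it.
\<close>

lemma nested_convex_min_norm:
  fixes D :: "nat \<Rightarrow> 'a::{real_inner, complete_space} set"
  assumes closed: "\<And>n. closed (D n)" and conv: "\<And>n. convex (D n)"
    and dec: "\<And>m n. m \<le> n \<Longrightarrow> D n \<subseteq> D m"
    and small: "\<And>n. \<exists>w\<in>D n. norm w \<le> B"
  obtains m where "\<And>n. m \<in> D n"
    "\<And>e. e > 0 \<Longrightarrow> \<exists>n \<delta>. \<delta> > 0 \<and> (\<forall>w\<in>D n. norm w \<le> norm m + \<delta> \<longrightarrow> norm (w - m) < e)"
proof -
  define \<mu> where "\<mu> n = Inf (norm ` D n)" for n
  have bd: "bdd_below (norm ` D n)" for n by (rule bdd_belowI[of _ 0]) auto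
  have \<mu>_le: "\<mu> n \<le> norm w" if "w \<in> D n" for w n
    using that bd by (auto simp: \<mu>_def intro: cINF_lower)
  have \<mu>_attained: "\<exists>w\<in>D n. norm w < \<mu> n + e" if "e > 0" for n e
    using cInf_lessD[of "norm ` D n" "\<mu> n + e"] small[of n] that by (auto simp: \<mu>_def)
  have \<mu>0: "0 \<le> \<mu> n" for n
    using small[of n] by (auto simp: \<mu>_def intro: cINF_greatest)
  have \<mu>B: "\<mu> n \<le> B" for n using small[of n] \<mu>_le by force
  have incs: "incseq \<mu>"
    unfolding incseq_def
  proof (intro allI impI)
    fix m n :: nat assume "m \<le> n"
    show "\<mu> m \<le> \<mu> n"
    proof (rule field_le_epsilon)
      fix e :: real assume "e > 0"
      then show "\<mu> m \<le> \<mu> n + e" using \<mu>_attained[of e n] \<mu>_le[of _ m] dec[OF \<open>m \<le> n\<close>] by force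
    qed
  qed
  obtain L where L: "\<mu> \<longlonglongrightarrow> L" and \<mu>L: "\<And>n. \<mu> n \<le> L"
    using incseq_convergent[OF incs, of B] \<mu>B by blast
  define T where "T n = D n \<inter> cball 0 (L + 1 / Suc n)" for n
  have inT: "w \<in> T n \<longleftrightarrow> w \<in> D n \<and> norm w \<le> L + 1 / Suc n" for w n by (simp add: T_def)
  have diam: "(dist v w)\<^sup>2 \<le> 4 * ((L + 1 / Suc n)\<^sup>2 - (\<mu> n)\<^sup>2)" if "v \<in> T n" "w \<in> T n" for v w n
  proof -
    have "(1/2) *\<^sub>R v + (1/2) *\<^sub>R w \<in> D n"
      using that by (intro convexD[OF conv]) (auto simp: inT)
    then have "\<mu> n \<le> norm ((1/2) *\<^sub>R (v + w))" using \<mu>_le by (simp add: scaleR_add_right)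
    then have "(\<mu> n)\<^sup>2 \<le> (norm ((1/2) *\<^sub>R (v + w)))\<^sup>2" using \<mu>0 by (intro power_mono) auto
    then have "4 * (\<mu> n)\<^sup>2 \<le> (norm (v + w))\<^sup>2" by (simp add: power_divide)
    moreover have "(norm v)\<^sup>2 \<le> (L + 1 / Suc n)\<^sup>2" "(norm w)\<^sup>2 \<le> (L + 1 / Suc n)\<^sup>2"
      using that by (auto simp: inT intro!: power_mono)
    moreover have "(norm (v - w))\<^sup>2 + (norm (v + w))\<^sup>2 = 2 * (norm v)\<^sup>2 + 2 * (norm w)\<^sup>2"
      by (simp add: power2_norm_eq_inner inner_add inner_diff inner_commute)
    ultimately show ?thesis by (simp add: dist_norm)
  qed
  have "(\<lambda>n. 4 * ((L + 1 / Suc n)\<^sup>2 - (\<mu> n)\<^sup>2)) \<longlonglongrightarrow> 4 * ((L + 0)\<^sup>2 - L\<^sup>2)"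
    using LIMSEQ_Suc[OF lim_1_over_n[where 'a=real]] by (intro tendsto_intros L) auto
  then have diam0: "(\<lambda>n. 4 * ((L + 1 / Suc n)\<^sup>2 - (\<mu> n)\<^sup>2)) \<longlonglongrightarrow> 0" by simp
  have small_diam: "\<exists>n. \<forall>v\<in>T n. \<forall>w\<in>T n. dist v w < e" if e: "e > 0" for e
  proof -
    have "eventually (\<lambda>n. 4 * ((L + 1 / Suc n)\<^sup>2 - (\<mu> n)\<^sup>2) < e\<^sup>2) sequentially"
      using diam0 e by (intro order_tendstoD(2)) auto
    then obtain n where n: "4 * ((L + 1 / Suc n)\<^sup>2 - (\<mu> n)\<^sup>2) < e\<^sup>2"
      by (auto simp: eventually_sequentially)
    have "dist v w < e" if "v \<in> T n" "w \<in> T n" for v w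
      using order_le_less_trans[OF diam[OF that] n] e by (simp add: power2_less_imp_less)
    then show ?thesis by blast
  qed
  have "\<exists>m. \<Inter>(range T) = {m}"
  proof (rule decreasing_closed_nest_sing)
    show "closed (T n)" for n unfolding T_def by (intro closed_Int closed closed_cball)
    show "T n \<noteq> {}" for n
      using \<mu>_attained[of "1 / Suc n" n] \<mu>L[of n] by (force simp: T_def)
    show "T n \<subseteq> T m" if "m \<le> n" for m n
    proof -
      have "1 / real (Suc n) \<le> 1 / real (Suc m)" using that by (intro divide_left_mono) auto
      then show ?thesis using dec[OF that] by (auto simp: T_def)
    qed
  qed (rule small_diam)
  then obtain m where m: "\<And>n. m \<in> T n" by blast
  have "norm m \<ge> L"
    using \<mu>_le m by (intro LIMSEQ_le_const2[OF L]) (auto simp: inT)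
  show ?thesis
  proof
    show "m \<in> D n" for n using m by (simp add: inT)
    fix e :: real assume "e > 0"
    then obtain n where n: "\<forall>v\<in>T n. \<forall>w\<in>T n. dist v w < e" using small_diam by blast
    have "norm (w - m) < e" if "w \<in> D n" "norm w \<le> norm m + 1 / Suc n" for w
    proof -
      have "norm m \<le> L"
      proof (rule LIMSEQ_le_const)
        show "(\<lambda>n. L + 1 / Suc n) \<longlonglongrightarrow> L"
          using tendsto_add[OF tendsto_const[of L] LIMSEQ_Suc[OF lim_1_over_n[where 'a=real]]] by simp
      qed (use m inT in blast)
      then have "w \<in> T n" using that by (simp add: inT)
      then show ?thesis using n m by (auto simp: dist_norm)
    qed
    then show "\<exists>n \<delta>. \<delta> > 0 \<and> (\<forall>w\<in>D n. norm w \<le> norm m + \<delta> \<longrightarrow> norm (w - m) < e)"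
      by (intro exI[of _ n] exI[of _ "1 / Suc n"]) auto
  qed
qed

lemma min_norm_eqI:
  assumes "m \<in> D" and "\<And>w. w \<in> D \<Longrightarrow> norm w \<le> norm m \<Longrightarrow> w = m"
  shows "min_norm D = m"
  unfolding min_norm_def
proof (rule the_equality)
  show "m \<in> D \<and> (\<forall>w\<in>D. norm m \<le> norm w)" using assms by (metis linear)
  show "v = m" if "v \<in> D \<and> (\<forall>w\<in>D. norm v \<le> norm w)" for v
    using assms(2)[of v] assms(1) that by blast
qed

text \<open>
  The constant sequence of sets already gives existence and uniqueness of the minimiser.
\<close>

lemma min_norm_closed_convex:
  fixes D :: "'a::{real_inner, complete_space} set"
  assumes "closed D" "convex D" "w0 \<in> D"
  shows "min_norm D \<in> D" "\<And>w. w \<in> D \<Longrightarrow> norm (min_norm D) \<le> norm w"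
proof -
  obtain m where m: "m \<in> D"
    "\<And>e. e > 0 \<Longrightarrow> \<exists>\<delta>. \<delta> > 0 \<and> (\<forall>w\<in>D. norm w \<le> norm m + \<delta> \<longrightarrow> norm (w - m) < e)"
    proof (rule nested_convex_min_norm[of "\<lambda>n. D" "norm w0"])
    show "\<exists>w\<in>D. norm w \<le> norm w0" using assms(3) by blast
  next
    fix m
    assume m: "\<And>n::nat. m \<in> D" "\<And>e. e > 0 \<Longrightarrow> \<exists>(n::nat) \<delta>. \<delta> > 0 \<and> (\<forall>w\<in>D. norm w \<le> norm m + \<delta> \<longrightarrow> norm (w - m) < e)"
    show thesis by (rule that[OF m(1)]) (use m(2) in blast)
  qed (use assms in auto)
  have *: "w = m" if "w \<in> D" "norm w \<le> norm m" for w
  proof (rule ccontr)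
    assume "w \<noteq> m"
    then obtain \<delta> where "\<delta> > 0" "\<forall>v\<in>D. norm v \<le> norm m + \<delta> \<longrightarrow> norm (v - m) < norm (w - m)"
      using m(2)[of "norm (w - m)"] by auto
    then show False using that by force
  qed
  then have "min_norm D = m" by (intro min_norm_eqI m(1))
  then show "min_norm D \<in> D" "\<And>w. w \<in> D \<Longrightarrow> norm (min_norm D) \<le> norm w"
    using m(1) * by (metis linear)+
qed

section \<open>Increments of absolutely continuous functions\<close>

lemma lipschitz_imp_abs_continuous:
  assumes "L-lipschitz_on {a..b} x"
  shows "abs_continuous a b x"
  unfolding abs_continuous_def
proof (intro allI impI)
  fix \<epsilon> :: real assume \<epsilon>: "\<epsilon> > 0"
  have L: "0 \<le> L" using assms by (rule lipschitz_on_nonneg)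
  have "(\<Sum>i<n. norm (x (v i) - x (u i))) < \<epsilon>"
    if uv: "\<forall>i<n. a \<le> u i \<and> u i \<le> v i \<and> v i \<le> b" and small: "(\<Sum>i<n. v i - u i) < \<epsilon> / (L + 1)"
    for n :: nat and u v
  proof -
    have "norm (x (v i) - x (u i)) \<le> L * (v i - u i)" if "i < n" for i
      using lipschitz_onD[OF assms, of "v i" "u i"] uv that by (force simp: dist_norm)
    then have "(\<Sum>i<n. norm (x (v i) - x (u i))) \<le> (\<Sum>i<n. L * (v i - u i))"
      by (intro sum_mono) auto
    also have "\<dots> = L * (\<Sum>i<n. v i - u i)" by (simp add: sum_distrib_left)
    also have "\<dots> \<le> L * (\<epsilon> / (L + 1))" using small L by (intro mult_left_mono) auto
    also have "\<dots> < \<epsilon>" using L \<epsilon> by (simp add: field_simps)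
    finally show ?thesis .
  qed
  moreover have "\<epsilon> / (L + 1) > 0" using L \<epsilon> by simp
  ultimately show "\<exists>\<delta>>0. \<forall>(n::nat) u v.
        (\<forall>i<n. a \<le> u i \<and> u i \<le> v i \<and> v i \<le> b) \<and>
        disjoint_family_on (\<lambda>i. {u i<..<v i}) {..<n} \<and>
        (\<Sum>i<n. v i - u i) < \<delta> \<longrightarrow> (\<Sum>i<n. norm (x (v i) - x (u i))) < \<epsilon>"
    by blast
qed

text \<open>
  Absolute continuity restated for tagged partial divisions, the form that gauge arguments deliver: the
  bound on the total length is replaced by inclusion in a set \<open>T\<close> of small measure.
\<close>

lemma abs_continuous_sum_over_tagged:
  fixes x :: "real \<Rightarrow> 'a::real_normed_vector"
  assumes "abs_continuous a b x" "\<epsilon> > 0"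
  obtains \<delta> where "\<delta> > 0"
    "\<And>p T. p tagged_partial_division_of {a..b} \<Longrightarrow> T \<in> lmeasurable \<Longrightarrow> measure lebesgue T < \<delta> \<Longrightarrow>
      (\<And>t K. (t, K) \<in> p \<Longrightarrow> K \<subseteq> T) \<Longrightarrow>
      (\<Sum>(t, K)\<in>p. norm (x (Sup K) - x (Inf K))) < \<epsilon>"
proof -
  obtain \<delta> where \<delta>: "\<delta> > 0" and ac: "\<And>(n::nat) u v.
        (\<forall>i<n. a \<le> u i \<and> u i \<le> v i \<and> v i \<le> b) \<and>
        disjoint_family_on (\<lambda>i. {u i<..<v i}) {..<n} \<and>
        (\<Sum>i<n. v i - u i) < \<delta> \<Longrightarrow> (\<Sum>i<n. norm (x (v i) - x (u i))) < \<epsilon>"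
    using assms unfolding abs_continuous_def by blast
  show ?thesis
  proof (rule that[OF \<delta>])
    fix p and T :: "real set"
    assume p: "p tagged_partial_division_of {a..b}" and T: "T \<in> lmeasurable" "measure lebesgue T < \<delta>"
      and sub: "\<And>t K. (t, K) \<in> p \<Longrightarrow> K \<subseteq> T"
    note pD = tagged_partial_division_ofD[OF p]
    have interval: "\<exists>u v. K = {u..v} \<and> u \<le> v \<and> Inf K = u \<and> Sup K = v \<and> a \<le> u \<and> v \<le> b \<and> K \<subseteq> T"
      if tK: "(t, K) \<in> p" for t K
    proof -
      obtain u v where K: "K = {u..v}" using pD(4)[OF tK] by auto
      have "u \<le> v" using pD(2)[OF tK] K by auto
      then show ?thesis using K pD(3)[OF tK] sub[OF tK] by auto
    qed
    obtain h where h: "bij_betw h {0..<card p} p"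
      using ex_bij_betw_nat_finite[OF pD(1)] by blast
    define n where "n = card p"
    have h': "bij_betw h {..<n} p" using h by (simp add: n_def atLeast0LessThan)
    define u v where "u i = Inf (snd (h i))" and "v i = Sup (snd (h i))" for i
    have hp: "h i \<in> p" if "i < n" for i using h' that by (auto simp: bij_betw_def)
    have uv: "a \<le> u i" "u i \<le> v i" "v i \<le> b" "snd (h i) = {u i..v i}" "{u i..v i} \<subseteq> T" if "i < n" for i
      using interval[of "fst (h i)" "snd (h i)"] hp[OF that] by (auto simp: u_def v_def)
    have disj: "disjoint_family_on (\<lambda>i. {u i<..<v i}) {..<n}"
      unfolding disjoint_family_on_def
    proof (intro ballI impI)
      fix i j assume ij: "i \<in> {..<n}" "j \<in> {..<n}" "i \<noteq> j"
      then have "h i \<noteq> h j" using h' by (auto simp: bij_betw_def inj_on_def)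
      then have "interior (snd (h i)) \<inter> interior (snd (h j)) = {}"
        using pD(5)[of "fst (h i)" "snd (h i)" "fst (h j)" "snd (h j)"] hp ij by simp
      then show "{u i<..<v i} \<inter> {u j<..<v j} = {}" using uv(4) ij by simp
    qed
    have "(\<Sum>i<n. v i - u i) = (\<Sum>i<n. measure lebesgue {u i<..<v i})"
      using uv(2) by (intro sum.cong) auto
    also have "\<dots> = measure lebesgue (\<Union>i<n. {u i<..<v i})"
      using disj by (intro measure_UNION'[symmetric])
        (auto simp: disjoint_family_on_def pairwise_def disjnt_def)
    also have "\<dots> \<le> measure lebesgue T"
    proof (intro measure_mono_fmeasurable T)
      show "(\<Union>i<n. {u i<..<v i}) \<subseteq> T" using uv(5) by (fastforce simp: subset_iff)
    qed auto
    also note T(2)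
    finally have "(\<Sum>i<n. norm (x (v i) - x (u i))) < \<epsilon>"
      using uv disj by (intro ac) auto
    also have "(\<Sum>i<n. norm (x (v i) - x (u i))) = (\<Sum>(t, K)\<in>p. norm (x (Sup K) - x (Inf K)))"
      using sum.reindex_bij_betw[OF h', of "\<lambda>(t, K). norm (x (Sup K) - x (Inf K))"]
      by (simp add: u_def v_def case_prod_beta)
    finally show "(\<Sum>(t, K)\<in>p. norm (x (Sup K) - x (Inf K))) < \<epsilon>" .
  qed
qed

text \<open>
  The straddle lemma, as an upper bound.
\<close>

lemma has_derivative_increment_bound:
  fixes \<phi> :: "real \<Rightarrow> real"
  assumes "(\<phi> has_real_derivative D) (at t within {a..b})" and "D \<le> M" and "e > 0"
  obtains d where "d > 0" "\<And>u v. u \<le> t \<Longrightarrow> t \<le> v \<Longrightarrow> a \<le> u \<Longrightarrow> v \<le> b \<Longrightarrow> t - d < u \<Longrightarrow> v < t + d \<Longrightarrow>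
    \<phi> v - \<phi> u \<le> (M + e) * (v - u)"
proof -
  obtain d where d: "d > 0" and
    bd: "\<And>s. s \<in> {a..b} \<Longrightarrow> \<bar>s - t\<bar> < d \<Longrightarrow> \<bar>\<phi> s - \<phi> t - D * (s - t)\<bar> \<le> e * \<bar>s - t\<bar>"
    using assms(1,3) unfolding has_field_derivative_def has_derivative_within_alt
    by (metis real_norm_def)
  show ?thesis
  proof (rule that[OF d])
    fix u v assume uv: "u \<le> t" "t \<le> v" "a \<le> u" "v \<le> b" "t - d < u" "v < t + d"
    have "\<bar>\<phi> u - \<phi> t - D * (u - t)\<bar> \<le> e * \<bar>u - t\<bar>" "\<bar>\<phi> v - \<phi> t - D * (v - t)\<bar> \<le> e * \<bar>v - t\<bar>"
      using bd[of u] bd[of v] uv by auto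
    then have "\<phi> v - \<phi> u \<le> (D + e) * (v - u)"
      using uv by (simp add: abs_le_iff algebra_simps)
    also have "\<dots> \<le> (M + e) * (v - u)" using assms(2) uv by (intro mult_right_mono) auto
    finally show "\<phi> v - \<phi> u \<le> (M + e) * (v - u)" .
  qed
qed

text \<open>
  A gauge argument that avoids the Lebesgue integral. At tags outside \<open>N\<close> the derivative controls the
  increment; tags in \<open>N\<close> are confined to an open set of small measure, where absolute continuity makes
  the increments small in total.
\<close>

lemma abs_continuous_increment_le:
  fixes \<phi> :: "real \<Rightarrow> real"
  assumes ab: "a \<le> b" and ac: "abs_continuous a b \<phi>" and N: "negligible N" and M: "0 \<le> M"
    and der: "\<And>t. t \<in> {a..b} - N \<Longrightarrow>
      \<exists>D\<le>M. (\<phi> has_real_derivative D) (at t within {a..b})"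
  shows "\<phi> b - \<phi> a \<le> M * (b - a)"
proof -
  have approx: "\<phi> b - \<phi> a \<le> M * (b - a) + (b - a + 1) * e" if e: "e > 0" for e
  proof -
    obtain \<delta> where \<delta>: "\<delta> > 0" and small:
      "\<And>p T. p tagged_partial_division_of {a..b} \<Longrightarrow> T \<in> lmeasurable \<Longrightarrow> measure lebesgue T < \<delta> \<Longrightarrow>
        (\<And>t K. (t, K) \<in> p \<Longrightarrow> K \<subseteq> T) \<Longrightarrow>
        (\<Sum>(t, K)\<in>p. norm (\<phi> (Sup K) - \<phi> (Inf K))) < e"
      using abs_continuous_sum_over_tagged[OF ac e] by blast
    obtain T where T: "open T" "N \<subseteq> T" "T \<in> lmeasurable" "measure lebesgue T < \<delta>"
    proof -
      have Nl: "N \<in> lmeasurable" "measure lebesgue N = 0"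
        using N by (auto simp: negligible_imp_measurable negligible_imp_measure0)
      obtain T where T: "open T" "N \<subseteq> T" "T - N \<in> lmeasurable" "emeasure lebesgue (T - N) < ennreal \<delta>"
        using sets_lebesgue_outer_open[OF fmeasurableD[OF Nl(1)] \<delta>] by blast
      have eq: "T = N \<union> (T - N)" using T(2) by blast
      have "measure lebesgue (T - N) < \<delta>"
        using T(3,4) \<delta> by (simp add: emeasure_eq_measure2 ennreal_less_iff)
      moreover have "measure lebesgue (N \<union> (T - N)) \<le> measure lebesgue N + measure lebesgue (T - N)"
        using Nl T(3) by (intro measure_Un_le) (auto dest: fmeasurableD)
      ultimately have "measure lebesgue T < \<delta>" using Nl(2) eq by simp
      moreover have "T \<in> lmeasurable" using fmeasurable.Un[OF Nl(1) T(3)] eq by simp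
      ultimately show ?thesis using that T(1,2) by blast
    qed
    have "\<exists>d>0. \<forall>u v. u \<le> t \<longrightarrow> t \<le> v \<longrightarrow> a \<le> u \<longrightarrow> v \<le> b \<longrightarrow> t - d < u \<longrightarrow> v < t + d \<longrightarrow>
        \<phi> v - \<phi> u \<le> (M + e) * (v - u)" if "t \<in> {a..b} - N" for t
      using der[OF that] has_derivative_increment_bound[OF _ _ e] by metis
    then obtain d where d0: "\<And>t. t \<in> {a..b} - N \<Longrightarrow> d t > 0"
      and d: "\<And>t u v. t \<in> {a..b} - N \<Longrightarrow> u \<le> t \<Longrightarrow> t \<le> v \<Longrightarrow> a \<le> u \<Longrightarrow> v \<le> b \<Longrightarrow> t - d t < u \<Longrightarrow>
        v < t + d t \<Longrightarrow> \<phi> v - \<phi> u \<le> (M + e) * (v - u)" by metis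
    \<comment> \<open>Intervals tagged in \<open>N\<close> must lie in \<open>T\<close>, the others within reach of the derivative at their tag.\<close>
    define \<gamma> where "\<gamma> t = (if t \<in> N then T else if t \<in> {a..b} then ball t (d t) else ball t 1)" for t
    have "gauge \<gamma>"
      using T d0 by (auto simp: gauge_def \<gamma>_def)
    then obtain p where p: "p tagged_division_of {a..b}" "\<gamma> fine p"
      using fine_division_exists_real by blast
    note pD = tagged_division_ofD[OF p(1)]
    define q where "q = {z\<in>p. fst z \<in> N}"
    have q: "q \<subseteq> p" "finite q" using pD(1) by (auto simp: q_def)
    have split: "(\<Sum>z\<in>p. g z) = (\<Sum>z\<in>p - q. g z) + (\<Sum>z\<in>q. g z)" for g :: "real \<times> real set \<Rightarrow> real"
      using sum.subset_diff[OF q(1) pD(1)] by simp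
    have "\<phi> b - \<phi> a = (\<Sum>(t, K)\<in>p. \<phi> (Sup K) - \<phi> (Inf K))"
      by (rule additive_tagged_division_1[OF ab p(1), symmetric])
    also have "\<dots> = (\<Sum>(t, K)\<in>p - q. \<phi> (Sup K) - \<phi> (Inf K)) + (\<Sum>(t, K)\<in>q. \<phi> (Sup K) - \<phi> (Inf K))"
      by (rule split)
    also have "(\<Sum>(t, K)\<in>q. \<phi> (Sup K) - \<phi> (Inf K)) \<le> e"
    proof -
      have "(\<Sum>(t, K)\<in>q. \<phi> (Sup K) - \<phi> (Inf K)) \<le> (\<Sum>(t, K)\<in>q. norm (\<phi> (Sup K) - \<phi> (Inf K)))"
        by (intro sum_mono) auto
      also have "\<dots> < e"
      proof (rule small[OF _ T(3,4)])
        show "q tagged_partial_division_of {a..b}"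
          using p(1) by (intro tagged_partial_division_subset[OF _ q(1)]) (simp add: tagged_division_of_def)
        show "K \<subseteq> T" if "(t, K) \<in> q" for t K
          using that fineD[OF p(2), of t K] by (auto simp: q_def \<gamma>_def)
      qed
      finally show ?thesis by simp
    qed
    also have "(\<Sum>(t, K)\<in>p - q. \<phi> (Sup K) - \<phi> (Inf K)) \<le> (\<Sum>(t, K)\<in>p - q. (M + e) * measure lborel K)"
    proof (intro sum_mono, clarify)
      fix t K assume tK: "(t, K) \<in> p" "(t, K) \<notin> q"
      then have t: "t \<in> {a..b} - N" using pD(2)[OF tK(1)] pD(3)[OF tK(1)] by (auto simp: q_def)
      obtain u v where K: "K = {u..v}" using pD(4)[OF tK(1)] by auto
      have tuv: "u \<le> t" "t \<le> v" using pD(2)[OF tK(1)] K by auto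
      have "K \<subseteq> ball t (d t)" using fineD[OF p(2) tK(1)] t by (auto simp: \<gamma>_def)
      moreover have "u \<in> K" "v \<in> K" using K tuv by auto
      ultimately have "u \<in> ball t (d t)" "v \<in> ball t (d t)" by blast+
      moreover have "a \<le> u" "v \<le> b" using pD(3)[OF tK(1)] K tuv by auto
      ultimately have "\<phi> v - \<phi> u \<le> (M + e) * (v - u)"
        using tuv by (intro d[OF t]) (auto simp: dist_real_def)
      then show "\<phi> (Sup K) - \<phi> (Inf K) \<le> (M + e) * measure lborel K" using K tuv by simp
    qed
    also have "\<dots> \<le> (\<Sum>(t, K)\<in>p. (M + e) * measure lborel K)"
      using M e pD(1) by (intro sum_mono2) (auto simp: case_prod_beta)
    also have "\<dots> = (M + e) * (b - a)"
      using additive_content_tagged_division[of p a b] p(1) ab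
      by (simp add: case_prod_beta sum_distrib_left[symmetric])
    finally show ?thesis by (simp add: algebra_simps)
  qed
  show ?thesis
  proof (rule field_le_epsilon)
    fix e :: real assume "e > 0"
    then show "\<phi> b - \<phi> a \<le> M * (b - a) + e"
      using approx[of "e / (b - a + 1)"] ab by simp
  qed
qed

text \<open>
  Reduction to the scalar case by taking the inner product with the direction of the total increment.
\<close>

lemma abs_continuous_norm_increment_le:
  fixes x :: "real \<Rightarrow> 'a::real_inner"
  assumes ab: "a \<le> b" and ac: "abs_continuous a b x" and N: "negligible N" and M: "0 \<le> M"
    and der: "\<And>t. t \<in> {a..b} - N \<Longrightarrow>
      \<exists>v. norm v \<le> M \<and> (x has_vector_derivative v) (at t within {a..b})"
  shows "norm (x b - x a) \<le> M * (b - a)"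
proof -
  define e where "e = sgn (x b - x a)"
  have e1: "norm e \<le> 1" by (simp add: e_def norm_sgn)
  have inner_e: "\<bar>w \<bullet> e\<bar> \<le> norm w" for w
    using Cauchy_Schwarz_ineq2[of w e] mult_left_mono[OF e1, of "norm w"] by simp
  have "abs_continuous a b (\<lambda>t. x t \<bullet> e)"
    unfolding abs_continuous_def
  proof (intro allI impI)
    fix \<epsilon> :: real assume "\<epsilon> > 0"
    then obtain \<delta> where \<delta>: "\<delta> > 0" "\<And>(n::nat) u v.
        (\<forall>i<n. a \<le> u i \<and> u i \<le> v i \<and> v i \<le> b) \<and> disjoint_family_on (\<lambda>i. {u i<..<v i}) {..<n} \<and>
        (\<Sum>i<n. v i - u i) < \<delta> \<Longrightarrow> (\<Sum>i<n. norm (x (v i) - x (u i))) < \<epsilon>"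
      using ac unfolding abs_continuous_def by blast
    have "(\<Sum>i<n. norm (x (v i) \<bullet> e - x (u i) \<bullet> e)) \<le> (\<Sum>i<n. norm (x (v i) - x (u i)))"
      for n :: nat and u v
      using inner_e by (intro sum_mono) (simp flip: inner_diff_left)
    with \<delta> show "\<exists>\<delta>>0. \<forall>(n::nat) u v.
        (\<forall>i<n. a \<le> u i \<and> u i \<le> v i \<and> v i \<le> b) \<and>
        disjoint_family_on (\<lambda>i. {u i<..<v i}) {..<n} \<and>
        (\<Sum>i<n. v i - u i) < \<delta> \<longrightarrow> (\<Sum>i<n. norm (x (v i) \<bullet> e - x (u i) \<bullet> e)) < \<epsilon>"
      by (meson order_le_less_trans)
  qed
  then have "x b \<bullet> e - x a \<bullet> e \<le> M * (b - a)"
  proof (rule abs_continuous_increment_le[OF ab _ N M])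
    fix t assume "t \<in> {a..b} - N"
    then obtain v where v: "norm v \<le> M" "(x has_vector_derivative v) (at t within {a..b})"
      using der by blast
    have "((\<lambda>t. x t \<bullet> e) has_real_derivative v \<bullet> e) (at t within {a..b})"
      using bounded_linear.has_vector_derivative[OF bounded_linear_inner_left v(2)]
      by (simp add: has_real_derivative_iff_has_vector_derivative)
    moreover have "v \<bullet> e \<le> M" using inner_e[of v] v(1) by simp
    ultimately show "\<exists>D\<le>M. ((\<lambda>t. x t \<bullet> e) has_real_derivative D) (at t within {a..b})" by blast
  qed
  moreover have "x b \<bullet> e - x a \<bullet> e = norm (x b - x a)"
    unfolding inner_diff_left[symmetric] e_def
    by (cases "x b = x a") (simp_all add: sgn_div_norm dot_square_norm power2_eq_square)
  ultimately show ?thesis by simp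
qed

text \<open>
  The norm is not differentiable where \<open>y\<close> vanishes, as it does initially when \<open>y\<close> is a displacement. It
  is replaced by the smooth function \<open>sqrt ((norm (y t))\<^sup>2 + \<epsilon>\<^sup>2)\<close>, written as the norm of the pair
  \<open>(y t, \<epsilon>)\<close>.
\<close>

lemma gronwall_norm:
  fixes y :: "real \<Rightarrow> 'a::real_inner"
  assumes ab: "a \<le> b" and lip: "L-lipschitz_on {a..b} y" and N: "negligible N"
    and c: "0 \<le> c" and K: "0 \<le> K"
    and der: "\<And>t. t \<in> {a..b} - N \<Longrightarrow> \<exists>v. (y has_vector_derivative v) (at t within {a..b}) \<and>
      v \<bullet> y t \<le> c * norm (y t) + K * (norm (y t))\<^sup>2"
  shows "norm (y b) \<le> exp (K * (b - a)) * (norm (y a) + c * (b - a))"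
proof -
  have L: "0 \<le> L" using lip by (rule lipschitz_on_nonneg)
  have approx: "norm (y b) \<le> exp (K * (b - a)) * (norm (y a) + \<epsilon> + c * (b - a))" if \<epsilon>: "\<epsilon> > 0" for \<epsilon> :: real
  proof -
    define \<phi> where "\<phi> t = norm (y t, \<epsilon>)" for t
    define E where "E t = exp (- K * (t - a))" for t
    have \<phi>0: "\<phi> t > 0" and \<phi>y: "norm (y t) \<le> \<phi> t" and \<phi>\<epsilon>: "\<phi> t \<le> norm (y t) + \<epsilon>" for t
      using \<epsilon> norm_Pair_le[of "y t" \<epsilon>] norm_fst_le[of "y t" \<epsilon>] by (auto simp: \<phi>_def zero_prod_def)
    have E0: "E t > 0" for t by (simp add: E_def)
    have E1: "E t \<le> 1" if "a \<le> t" for t using that K by (simp add: E_def)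
    have \<phi>lip: "\<bar>\<phi> t - \<phi> s\<bar> \<le> L * \<bar>t - s\<bar>" if "s \<in> {a..b}" "t \<in> {a..b}" for s t
    proof -
      have "\<bar>\<phi> t - \<phi> s\<bar> \<le> norm ((y t, \<epsilon>) - (y s, \<epsilon>))" unfolding \<phi>_def by (rule norm_triangle_ineq3)
      also have "\<dots> = norm (y t - y s)" by (simp add: norm_Pair)
      also have "\<dots> \<le> L * \<bar>t - s\<bar>"
        using lipschitz_onD[OF lip that(2,1)] by (simp add: dist_norm)
      finally show ?thesis .
    qed
    define B where "B = \<phi> a + L * (b - a)"
    have \<phi>B: "\<phi> t \<le> B" if "t \<in> {a..b}" for t
    proof -
      have "\<phi> t \<le> \<phi> a + L * \<bar>t - a\<bar>" using \<phi>lip[of a t] that ab by auto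
      also have "\<dots> \<le> B" unfolding B_def using that L by (auto intro!: mult_left_mono)
      finally show ?thesis .
    qed
    have EK: "\<bar>E t - E s\<bar> \<le> K * \<bar>t - s\<bar>" if "a \<le> s" "a \<le> t" for s t
    proof -
      have mono: "E s - E t \<le> K * (t - s)" "E t \<le> E s" if "a \<le> s" "s \<le> t" for s t
      proof -
        have "E t = E s * exp (- (K * (t - s)))" by (simp add: E_def algebra_simps flip: exp_add)
        then have "E s - E t = E s * (1 - exp (- (K * (t - s))))" by (simp add: algebra_simps)
        also have "\<dots> \<le> 1 * (K * (t - s))"
          using exp_ge_add_one_self[of "- (K * (t - s))"] E0[of s] E1[OF that(1)] K that
          by (intro mult_mono) auto
        finally show "E s - E t \<le> K * (t - s)" by simp
        show "E t \<le> E s" using K that by (simp add: E_def mult_left_mono)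
      qed
      show ?thesis
        using mono[of s t] mono[of t s] that by (cases "s \<le> t") auto
    qed
    have "(L + K * B)-lipschitz_on {a..b} (\<lambda>t. E t * \<phi> t)"
    proof (rule lipschitz_onI)
      show "0 \<le> L + K * B" using L K \<phi>0[of a] ab by (simp add: B_def)
    next
      fix t s assume ts: "t \<in> {a..b}" "s \<in> {a..b}"
      have "E t * \<phi> t - E s * \<phi> s = E t * (\<phi> t - \<phi> s) + (E t - E s) * \<phi> s"
        by (simp add: algebra_simps)
      then have "\<bar>E t * \<phi> t - E s * \<phi> s\<bar> \<le> E t * \<bar>\<phi> t - \<phi> s\<bar> + \<bar>E t - E s\<bar> * \<phi> s"
        using abs_triangle_ineq[of "E t * (\<phi> t - \<phi> s)" "(E t - E s) * \<phi> s"] E0[of t] \<phi>0[of s]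
        by (simp add: abs_mult)
      also have "\<dots> \<le> 1 * (L * \<bar>t - s\<bar>) + (K * \<bar>t - s\<bar>) * B"
        using ts \<phi>lip[of s t] EK[of s t] E1[of t] \<phi>B[of s] E0[of t] \<phi>0[of s] K L
        by (intro add_mono mult_mono) auto
      finally show "dist (E t * \<phi> t) (E s * \<phi> s) \<le> (L + K * B) * dist t s"
        by (simp add: dist_real_def algebra_simps)
    qed
    then have "abs_continuous a b (\<lambda>t. E t * \<phi> t)" by (rule lipschitz_imp_abs_continuous)
    then have "E b * \<phi> b - E a * \<phi> a \<le> c * (b - a)"
    proof (rule abs_continuous_increment_le[OF ab _ N c])
      fix t assume t: "t \<in> {a..b} - N"
      then obtain v where v: "(y has_vector_derivative v) (at t within {a..b})"
        "v \<bullet> y t \<le> c * norm (y t) + K * (norm (y t))\<^sup>2" using der by blast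
      have "((\<lambda>t. (y t, \<epsilon>)) has_derivative (\<lambda>h. (h *\<^sub>R v, 0))) (at t within {a..b})"
        using v(1) unfolding has_vector_derivative_def
        by (intro has_derivative_Pair) auto
      then have "(\<phi> has_derivative (\<lambda>h. (h *\<^sub>R v, 0) \<bullet> sgn (y t, \<epsilon>))) (at t within {a..b})"
        unfolding \<phi>_def using \<epsilon>
        by (intro has_derivative_compose[OF _ has_derivative_norm]) (auto simp: zero_prod_def)
      then have D\<phi>: "(\<phi> has_real_derivative (v \<bullet> y t) / \<phi> t) (at t within {a..b})"
        unfolding has_field_derivative_def
        by (rule has_derivative_eq_rhs) (auto simp: sgn_div_norm \<phi>_def field_simps)
      have DE: "(E has_real_derivative - K * E t) (at t within {a..b})"
        unfolding E_def by (auto intro!: derivative_eq_intros)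
      have "((\<lambda>t. E t * \<phi> t) has_real_derivative E t * ((v \<bullet> y t) / \<phi> t) + (- K * E t) * \<phi> t)
          (at t within {a..b})"
        using DERIV_mult[OF DE D\<phi>] by (simp add: algebra_simps)
      moreover have "E t * ((v \<bullet> y t) / \<phi> t) + (- K * E t) * \<phi> t \<le> c"
      proof -
        have "v \<bullet> y t \<le> c * \<phi> t + K * (\<phi> t)\<^sup>2"
          using v(2) mult_left_mono[OF \<phi>y[of t] c]
            mult_left_mono[OF power_mono[OF \<phi>y[of t] norm_ge_zero, of 2] K] by linarith
        then have "(v \<bullet> y t) / \<phi> t \<le> c + K * \<phi> t"
          using \<phi>0[of t] by (simp add: pos_divide_le_eq power2_eq_square algebra_simps)
        then have "E t * ((v \<bullet> y t) / \<phi> t - K * \<phi> t) \<le> E t * c"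
          using E0[of t] by (intro mult_left_mono) auto
        also have "\<dots> \<le> c" using E1[of t] t c mult_right_mono[of "E t" 1 c] by simp
        finally show ?thesis by (simp add: algebra_simps)
      qed
      ultimately show "\<exists>D\<le>c. ((\<lambda>t. E t * \<phi> t) has_real_derivative D) (at t within {a..b})" by blast
    qed
    then have "E b * \<phi> b \<le> \<phi> a + c * (b - a)" by (simp add: E_def)
    then have "exp (K * (b - a)) * (E b * \<phi> b) \<le> exp (K * (b - a)) * (\<phi> a + c * (b - a))"
      by (intro mult_left_mono) auto
    moreover have "exp (K * (b - a)) * (E b * \<phi> b) = \<phi> b"
      by (simp add: E_def flip: mult.assoc exp_add)
    ultimately have "\<phi> b \<le> exp (K * (b - a)) * (\<phi> a + c * (b - a))" by simp
    also have "\<dots> \<le> exp (K * (b - a)) * (norm (y a) + \<epsilon> + c * (b - a))"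
      using \<phi>\<epsilon>[of a] by (intro mult_left_mono) auto
    finally show ?thesis using \<phi>y[of b] by linarith
  qed
  show ?thesis
  proof (rule field_le_epsilon)
    fix e :: real assume "e > 0"
    then show "norm (y b) \<le> exp (K * (b - a)) * (norm (y a) + c * (b - a)) + e"
      using approx[of "e / exp (K * (b - a))"] by (simp add: algebra_simps)
  qed
qed

section \<open>Curves in a set and their velocities\<close>

lemma abs_continuous_imp_continuous_on:
  assumes "abs_continuous a b x"
  shows "continuous_on {a..b} x"
proof -
  have "\<exists>\<delta>>0. \<forall>t\<in>{a..b}. \<forall>s\<in>{a..b}. dist s t < \<delta> \<longrightarrow> dist (x s) (x t) < e" if e: "e > 0" for e
  proof -
    obtain \<delta> where \<delta>: "\<delta> > 0" "\<And>(n::nat) u v.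
        (\<forall>i<n. a \<le> u i \<and> u i \<le> v i \<and> v i \<le> b) \<and> disjoint_family_on (\<lambda>i. {u i<..<v i}) {..<n} \<and>
        (\<Sum>i<n. v i - u i) < \<delta> \<Longrightarrow> (\<Sum>i<n. norm (x (v i) - x (u i))) < e"
      using assms e unfolding abs_continuous_def by blast
    have one: "norm (x v - x u) < e" if "a \<le> u" "u \<le> v" "v \<le> b" "v - u < \<delta>" for u v
      using \<delta>(2)[of 1 "\<lambda>_. u" "\<lambda>_. v"] that by (simp add: disjoint_family_on_def)
    have "dist (x s) (x t) < e" if "t \<in> {a..b}" "s \<in> {a..b}" "dist s t < \<delta>" for s t
      using one[of s t] one[of t s] that
      by (cases "s \<le> t") (auto simp: dist_norm norm_minus_commute)
    with \<delta>(1) show ?thesis by blast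
  qed
  then show ?thesis
    by (intro uniformly_continuous_imp_continuous) (simp add: uniformly_continuous_on_def)
qed

lemma AE_lebesgue_on_Ici_iff:
  "(AE t in lebesgue_on {0::real..}. P t) \<longleftrightarrow> (\<exists>N. negligible N \<and> (\<forall>t\<ge>0. t \<notin> N \<longrightarrow> P t))"
proof -
  have "(AE t in lebesgue_on {0::real..}. P t) \<longleftrightarrow> (AE t in lebesgue. t \<in> {0..} \<longrightarrow> P t)"
    by (intro AE_restrict_space_iff) auto
  also have "\<dots> \<longleftrightarrow> (\<exists>N. negligible N \<and> (\<forall>t\<ge>0. t \<notin> N \<longrightarrow> P t))"
    unfolding eventually_ae_filter negligible_iff_null_sets by auto
  finally show ?thesis .
qed

text \<open>
  The function \<open>\<sigma> * (norm (x s - x t))\<^sup>2 - \<xi> \<bullet> (x s - x t)\<close> has a minimum at \<open>s = t\<close>, and its derivative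
  there is \<open>- (\<xi> \<bullet> v)\<close>.
\<close>

lemma normal_orthogonal_velocity:
  fixes x :: "real \<Rightarrow> 'a::real_inner"
  assumes t: "0 < t" and v: "(x has_vector_derivative v) (at t within {0..})"
    and le: "\<And>s. 0 \<le> s \<Longrightarrow> \<xi> \<bullet> (x s - x t) \<le> \<sigma> * (norm (x s - x t))\<^sup>2"
  shows "\<xi> \<bullet> v = 0"
proof -
  have "at t within {0..} = at t"
    using t by (intro at_within_interior) simp
  with v have x': "(x has_derivative (\<lambda>h. h *\<^sub>R v)) (at t)"
    by (simp add: has_vector_derivative_def)
  define g where "g s = \<sigma> * ((x s - x t) \<bullet> (x s - x t)) - \<xi> \<bullet> (x s - x t)" for s
  have "(g has_real_derivative - (\<xi> \<bullet> v)) (at t)"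
    unfolding g_def has_field_derivative_def
    by (auto intro!: derivative_eq_intros x' simp: algebra_simps fun_eq_iff)
  moreover have "g t \<le> g s" if "\<bar>t - s\<bar> < t" for s
    using le[of s] that by (simp add: g_def power2_norm_eq_inner)
  ultimately have "- (\<xi> \<bullet> v) = 0" using t by (intro DERIV_local_min[of g _ t t]) auto
  then show ?thesis by simp
qed

section \<open>Velocities of the perturbed sweeping process\<close>

text \<open>
  The number \<open>\<rho>\<close> is a finite radius below \<open>r\<close>, so that the case \<open>r = \<infinity>\<close> needs no separate treatment.
\<close>

locale sweeping_process =
  fixes C :: "'a::{real_inner, complete_space} set" and r :: ereal and \<rho> k :: real
    and f :: "'a \<Rightarrow> 'a"
  assumes closed_C: "closed C" and prox_regular_C: "prox_regular r C"
    and \<rho>: "0 < \<rho>" "ereal \<rho> < r"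
    and lip_f: "k-lipschitz_on UNIV f"
begin

abbreviation min_velocity :: "'a \<Rightarrow> 'a" where
  "min_velocity p \<equiv> min_norm (velocities f C p)"

lemma k_nonneg: "0 \<le> k" using lip_f by (rule lipschitz_on_nonneg)

lemma norm_f_diff_le: "norm (f p - f q) \<le> k * norm (p - q)"
  using lipschitz_onD[OF lip_f, of p q] by (simp add: dist_norm)

lemma velocities_iff: "v \<in> velocities f C p \<longleftrightarrow> f p - v \<in> prox_normal_cone C p"
  unfolding velocities_def by (force simp: image_iff)

lemma velocitiesD: "v \<in> velocities f C p \<Longrightarrow> p \<in> C"
  by (simp add: velocities_iff in_prox_normal_coneD)

lemma normal_le:
  assumes "v \<in> velocities f C p" "norm v \<le> B" "norm (f p) \<le> B" "y \<in> C"
  shows "(f p - v) \<bullet> (y - p) \<le> B / \<rho> * (norm (y - p))\<^sup>2"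
proof -
  have "(f p - v) \<bullet> (y - p) \<le> norm (f p - v) / (2 * \<rho>) * (norm (y - p))\<^sup>2"
    using prox_normal_cone_inner_le[OF prox_regular_C \<rho> _ assms(4)] assms(1) by (simp add: velocities_iff)
  also have "\<dots> \<le> (2 * B) / (2 * \<rho>) * (norm (y - p))\<^sup>2"
    using norm_triangle_ineq4[of "f p" v] assms(2,3) \<rho>
    by (intro mult_right_mono divide_right_mono) auto
  finally show ?thesis by simp
qed

lemma min_velocity_in: "p \<in> C \<Longrightarrow> min_velocity p \<in> velocities f C p"
  using min_norm_closed_convex(1) velocities_closed_convex[OF prox_regular_C \<rho>] by metis

lemma min_velocity_le: "v \<in> velocities f C p \<Longrightarrow> norm (min_velocity p) \<le> norm v"
  using min_norm_closed_convex(2) velocities_closed_convex[OF prox_regular_C \<rho>] velocitiesD by metis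

lemma norm_min_velocity_le_f: "p \<in> C \<Longrightarrow> norm (min_velocity p) \<le> norm (f p)"
  using min_velocity_le velocities_closed_convex(3)[OF prox_regular_C \<rho>] by blast

text \<open>
  Hypomonotonicity of the normal cone: add the normal inequalities at \<open>p\<close> tested with \<open>q\<close> and at \<open>q\<close>
  tested with \<open>p\<close>.
\<close>

lemma velocities_one_sided_lipschitz:
  assumes "v \<in> velocities f C p" "norm v \<le> B" "norm (f p) \<le> B"
    and "w \<in> velocities f C q" "norm w \<le> B" "norm (f q) \<le> B"
  shows "(v - w) \<bullet> (p - q) \<le> (k + 2 * B / \<rho>) * (norm (p - q))\<^sup>2"
proof -
  have "(f p - f q) \<bullet> (p - q) \<le> norm (f p - f q) * norm (p - q)" by (rule norm_cauchy_schwarz)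
  also have "\<dots> \<le> k * norm (p - q) * norm (p - q)"
    using norm_f_diff_le by (intro mult_right_mono) auto
  finally have "(f p - f q) \<bullet> (p - q) \<le> k * (norm (p - q))\<^sup>2"
    by (simp add: power2_eq_square)
  moreover have "(f p - v) \<bullet> (q - p) \<le> B / \<rho> * (norm (p - q))\<^sup>2"
    using normal_le[OF assms(1-3) velocitiesD[OF assms(4)]] by (simp add: norm_minus_commute)
  moreover have "(f q - w) \<bullet> (p - q) \<le> B / \<rho> * (norm (p - q))\<^sup>2"
    using normal_le[OF assms(4-6) velocitiesD[OF assms(1)]] .
  moreover have "(v - w) \<bullet> (p - q) =
      (f p - f q) \<bullet> (p - q) + (f p - v) \<bullet> (q - p) + (f q - w) \<bullet> (p - q)"
    by (simp add: inner_diff algebra_simps)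
  moreover have "(k + 2 * B / \<rho>) * (norm (p - q))\<^sup>2 =
      k * (norm (p - q))\<^sup>2 + B / \<rho> * (norm (p - q))\<^sup>2 + B / \<rho> * (norm (p - q))\<^sup>2"
    by (simp add: algebra_simps)
  ultimately show ?thesis by linarith
qed

text \<open>
  Velocities at points \<open>q\<close> near \<open>p\<close> satisfy the inequalities that characterise velocities at \<open>p\<close>, up to an
  error that vanishes with \<open>d\<close>. For the strong convergence below the error has to be uniform in \<open>y\<close>, up
  to a fixed weight in \<open>y\<close>; whence the factor \<open>1 + norm (y - p)\<close>, as \<open>C\<close> may be unbounded.
\<close>

lemma velocity_near_le:
  assumes v: "v \<in> velocities f C q" "norm v \<le> B" "norm (f q) \<le> B"
    and d: "norm (q - p) \<le> d" and y: "y \<in> C"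
  shows "(f p - v) \<bullet> (y - p) \<le> B / \<rho> * (norm (y - p))\<^sup>2
    + d * (k + 2 * B / \<rho> + B / \<rho> * d + 2 * B) * (1 + norm (y - p))"
proof -
  define Y where "Y = norm (y - p)"
  define c where "c = B / \<rho>"
  have d0: "0 \<le> d" using d norm_ge_zero order_trans by blast
  have B0: "0 \<le> B" using v(2) norm_ge_zero order_trans by blast
  have c0: "0 \<le> c" using B0 \<rho> by (simp add: c_def)
  have Y0: "0 \<le> Y" by (simp add: Y_def)
  have "(f p - f q) \<bullet> (y - p) \<le> norm (f p - f q) * Y" unfolding Y_def by (rule norm_cauchy_schwarz)
  also have "\<dots> \<le> (k * d) * Y"
    using order_trans[OF norm_f_diff_le[of p q] mult_left_mono[OF d k_nonneg, folded norm_minus_commute[of p q]]] Y0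
    by (intro mult_right_mono) auto
  finally have 1: "(f p - f q) \<bullet> (y - p) \<le> k * d * Y" .
  have "(f q - v) \<bullet> (y - q) \<le> c * (norm (y - q))\<^sup>2"
    unfolding c_def by (rule normal_le[OF v y])
  also have "\<dots> \<le> c * (Y + d)\<^sup>2"
    using norm_triangle_ineq[of "y - p" "p - q"] d c0
    by (intro mult_left_mono power_mono) (auto simp: Y_def norm_minus_commute)
  finally have 2: "(f q - v) \<bullet> (y - q) \<le> c * (Y + d)\<^sup>2" .
  have "(f q - v) \<bullet> (q - p) \<le> norm (f q - v) * norm (q - p)" by (rule norm_cauchy_schwarz)
  also have "\<dots> \<le> (2 * B) * d"
    using norm_triangle_ineq4[of "f q" v] v d B0 by (intro mult_mono) auto
  finally have 3: "(f q - v) \<bullet> (q - p) \<le> 2 * B * d" .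
  have "(f p - v) \<bullet> (y - p) = (f p - f q) \<bullet> (y - p) + (f q - v) \<bullet> (y - q) + (f q - v) \<bullet> (q - p)"
    by (simp add: inner_diff algebra_simps)
  also have "\<dots> \<le> k * d * Y + c * (Y + d)\<^sup>2 + 2 * B * d" using 1 2 3 by simp
  also have "\<dots> \<le> c * Y\<^sup>2 + d * (k + 2 * c + c * d + 2 * B) * (1 + Y)"
  proof -
    have "0 \<le> d * k + 2 * (d * c) + c * d * d * Y + 2 * B * d * Y"
      using d0 k_nonneg c0 B0 Y0 by simp
    then show ?thesis by (simp add: power2_eq_square algebra_simps)
  qed
  finally show ?thesis by (simp add: c_def Y_def)
qed

text \<open>
  The convergence principle for both parts of (ii). Relaxing the inequalities that describe the velocities
  at \<open>p\<close> yields decreasing closed convex sets \<open>D n\<close>. Their intersection consists of velocities at \<open>p\<close>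
  and contains the one of minimal norm, so the limit of almost minimal elements of \<open>D n\<close> is that
  velocity; and the \<open>w i\<close> eventually are such elements.
\<close>

lemma tendsto_min_velocity:
  assumes p: "p \<in> C"
    and norm_le: "\<forall>\<^sub>F i in F. norm (w i) \<le> g i" and g: "(g \<longlongrightarrow> norm (min_velocity p)) F"
    and normal: "\<forall>\<^sub>F i in F. \<forall>y\<in>C. (f p - w i) \<bullet> (y - p) \<le> c * (norm (y - p))\<^sup>2 + a i * (1 + norm (y - p))"
    and a: "(a \<longlongrightarrow> 0) F"
    and c: "norm (f p - min_velocity p) / (2 * \<rho>) \<le> c"
  shows "(w \<longlongrightarrow> min_velocity p) F"
proof -
  define z where "z = min_velocity p"
  define D where "D n = {w. \<forall>y\<in>C. (f p - w) \<bullet> (y - p) \<le> c * (norm (y - p))\<^sup>2 + 1 / Suc n * (1 + norm (y - p))}"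
    for n :: nat
  have z: "z \<in> D n" for n
  proof -
    have "(f p - z) \<bullet> (y - p) \<le> c * (norm (y - p))\<^sup>2 + 1 / Suc n * (1 + norm (y - p))" if "y \<in> C" for y
    proof -
      have "(f p - z) \<bullet> (y - p) \<le> norm (f p - z) / (2 * \<rho>) * (norm (y - p))\<^sup>2"
        using min_velocity_in[OF p] prox_normal_cone_inner_le[OF prox_regular_C \<rho> _ that]
        by (simp add: z_def velocities_iff)
      also have "\<dots> \<le> c * (norm (y - p))\<^sup>2" using c by (intro mult_right_mono) (auto simp: z_def)
      finally show ?thesis by (simp add: add_increasing2)
    qed
    then show ?thesis by (simp add: D_def)
  qed
  obtain m where m: "\<And>n. m \<in> D n"
    and m_strong: "\<And>e. e > 0 \<Longrightarrow> \<exists>n \<delta>. \<delta> > 0 \<and> (\<forall>w\<in>D n. norm w \<le> norm m + \<delta> \<longrightarrow> norm (w - m) < e)"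
  proof (rule nested_convex_min_norm[of D "norm z"])
    fix n :: nat
    have D_Inter: "D n = (\<Inter>y\<in>C. {w. (f p - w) \<bullet> (y - p) \<le> c * (norm (y - p))\<^sup>2 + 1 / Suc n * (1 + norm (y - p))})"
      by (auto simp: D_def)
    show "closed (D n)"
      unfolding D_Inter by (intro closed_INT ballI closed_Collect_le continuous_intros)
    show "convex (D n)"
      unfolding D_Inter
    proof (intro convex_INT)
      fix y assume "y \<in> C"
      have "{w. (f p - w) \<bullet> (y - p) \<le> c * (norm (y - p))\<^sup>2 + 1 / Suc n * (1 + norm (y - p))}
          = {w. (y - p) \<bullet> w \<ge> f p \<bullet> (y - p) - (c * (norm (y - p))\<^sup>2 + 1 / Suc n * (1 + norm (y - p)))}"
        by (auto simp: inner_diff inner_commute algebra_simps)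
      then show "convex {w. (f p - w) \<bullet> (y - p) \<le> c * (norm (y - p))\<^sup>2 + 1 / Suc n * (1 + norm (y - p))}"
        by (simp add: convex_halfspace_ge)
    qed
    show "\<exists>w\<in>D n. norm w \<le> norm z" using z by blast
  next
    fix m n :: nat assume "m \<le> n"
    then have "1 / real (Suc n) \<le> 1 / real (Suc m)" by (intro divide_left_mono) auto
    then have "1 / Suc n * (1 + norm (y - p)) \<le> 1 / Suc m * (1 + norm (y - p))" for y
      by (intro mult_right_mono) auto
    then show "D n \<subseteq> D m" unfolding D_def by (smt (verit) Collect_mono)
  qed blast
  have m_vel: "m \<in> velocities f C p"
    unfolding velocities_iff
  proof (rule prox_normal_coneI[OF p])
    fix y assume y: "y \<in> C"
    have "(f p - m) \<bullet> (y - p) - c * (norm (y - p))\<^sup>2 \<le> 0"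
    proof (rule LIMSEQ_le_const)
      show "(\<lambda>n. 1 / Suc n * (1 + norm (y - p))) \<longlonglongrightarrow> 0"
        using tendsto_mult_right[OF LIMSEQ_Suc[OF lim_1_over_n[where 'a=real]], of "1 + norm (y - p)"] by simp
      show "\<exists>N. \<forall>n\<ge>N. (f p - m) \<bullet> (y - p) - c * (norm (y - p))\<^sup>2 \<le> 1 / Suc n * (1 + norm (y - p))"
      proof (intro exI allI impI)
        fix n :: nat
        have "(f p - m) \<bullet> (y - p) \<le> c * (norm (y - p))\<^sup>2 + 1 / Suc n * (1 + norm (y - p))"
          using m[of n] y unfolding D_def by blast
        then show "(f p - m) \<bullet> (y - p) - c * (norm (y - p))\<^sup>2 \<le> 1 / Suc n * (1 + norm (y - p))"
          by linarith
      qed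
    qed
    then show "(f p - m) \<bullet> (y - p) \<le> c * (norm (y - p))\<^sup>2" by simp
  qed
  have zm: "norm z \<le> norm m" unfolding z_def by (rule min_velocity_le[OF m_vel])
  have "m = z"
  proof (rule ccontr)
    assume "m \<noteq> z"
    then obtain n \<delta> where "\<delta> > 0" "\<forall>w\<in>D n. norm w \<le> norm m + \<delta> \<longrightarrow> norm (w - m) < norm (z - m)"
      using m_strong[of "norm (z - m)"] by auto
    then show False using z[of n] zm by force
  qed
  have "(w \<longlongrightarrow> z) F"
  proof (rule tendstoI)
    fix e :: real assume "e > 0"
    then obtain n \<delta> where \<delta>: "\<delta> > 0" and
      n: "\<And>w. w \<in> D n \<Longrightarrow> norm w \<le> norm z + \<delta> \<Longrightarrow> norm (w - z) < e"
      using m_strong \<open>m = z\<close> by blast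
    have "\<forall>\<^sub>F i in F. a i < 1 / Suc n" using a by (rule order_tendstoD) simp
    moreover have "\<forall>\<^sub>F i in F. g i < norm z + \<delta>" using g \<delta> by (intro order_tendstoD) (auto simp: z_def)
    ultimately show "\<forall>\<^sub>F i in F. dist (w i) z < e"
      using norm_le normal
    proof eventually_elim
      case (elim i)
      have "w i \<in> D n"
        unfolding D_def
      proof (intro CollectI ballI)
        fix y assume "y \<in> C"
        then have "(f p - w i) \<bullet> (y - p) \<le> c * (norm (y - p))\<^sup>2 + a i * (1 + norm (y - p))"
          using elim by blast
        moreover have "a i * (1 + norm (y - p)) \<le> 1 / Suc n * (1 + norm (y - p))"
          using elim by (intro mult_right_mono) auto
        ultimately show "(f p - w i) \<bullet> (y - p) \<le> c * (norm (y - p))\<^sup>2 + 1 / Suc n * (1 + norm (y - p))"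
          by linarith
      qed
      moreover have "norm (w i) \<le> norm z + \<delta>" using elim by simp
      ultimately show ?case using n by (simp add: dist_norm)
    qed
  qed
  then show ?thesis by (simp add: z_def)
qed

end

section \<open>Solutions and their almost everywhere derivative\<close>

locale sweeping_solution = sweeping_process +
  fixes x :: "real \<Rightarrow> 'a" and x0 :: 'a
  assumes solution: "is_solution f C x0 x"
begin

lemma ae_velocity:
  obtains N where "negligible N" "0 \<in> N"
    "\<And>t. 0 \<le> t \<Longrightarrow> t \<notin> N \<Longrightarrow> \<exists>v\<in>velocities f C (x t). (x has_vector_derivative v) (at t within {0..})"
proof -
  obtain N where N: "negligible N"
    "\<And>t. 0 \<le> t \<Longrightarrow> t \<notin> N \<Longrightarrow> \<exists>v\<in>velocities f C (x t). (x has_vector_derivative v) (at t within {0..})"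
    using solution unfolding is_solution_def AE_lebesgue_on_Ici_iff by blast
  show ?thesis by (rule that[of "insert 0 N"]) (use N in auto)
qed

lemma continuous_on_solution: "continuous_on {0..b} x"
proof (cases "0 \<le> b")
  case True
  then show ?thesis
    using solution by (intro abs_continuous_imp_continuous_on) (auto simp: is_solution_def loc_abs_continuous_def)
qed simp

text \<open>
  At almost every time the set of velocities is nonempty, so the solution is in \<open>C\<close> on a dense set of
  times, and \<open>C\<close> is closed.
\<close>

lemma solution_in_C:
  assumes t: "0 \<le> t"
  shows "x t \<in> C"
proof (rule ccontr)
  assume nC: "x t \<notin> C"
  obtain N where N: "negligible N"
    "\<And>t. 0 \<le> t \<Longrightarrow> t \<notin> N \<Longrightarrow> \<exists>v\<in>velocities f C (x t). (x has_vector_derivative v) (at t within {0..})"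
    using ae_velocity by metis
  obtain e where e: "e > 0" "ball (x t) e \<subseteq> - C"
    using nC closed_C open_contains_ball[of "- C"] by (auto simp: open_Compl)
  obtain d where d: "d > 0" "\<And>s. s \<in> {0..t+1} \<Longrightarrow> dist s t < d \<Longrightarrow> dist (x s) (x t) < e"
    using continuous_on_solution[of "t + 1"] t e(1) unfolding continuous_on_iff
    by (metis add_increasing2 atLeastAtMost_iff le_add_same_cancel1 zero_le_one)
  define m where "m = min (d / 2) 1"
  have m: "0 < m" "m \<le> 1" "m < d" using d by (auto simp: m_def)
  have "{t..t + m} \<subseteq> N"
  proof
    fix s assume s: "s \<in> {t..t + m}"
    then have "dist (x s) (x t) < e" using t m by (intro d(2)) (auto simp: dist_real_def)
    then have "x s \<notin> C" using e(2) by (auto simp: dist_commute)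
    then show "s \<in> N" using N(2)[of s] velocitiesD s t by force
  qed
  then have "negligible {t..t + m}" using N(1) negligible_subset by blast
  then have "negligible (cbox t (t + m))" by simp
  then show False using m unfolding negligible_interval by simp
qed

text \<open>
  The derivative \<open>v\<close> is orthogonal to all normals, hence also to the difference of any two velocities;
  Pythagoras then gives that \<open>v\<close> is the shortest of them.
\<close>

lemma derivative_is_min_velocity:
  assumes t: "0 < t" and v: "v \<in> velocities f C (x t)" "(x has_vector_derivative v) (at t within {0..})"
  shows "min_velocity (x t) = v"
proof (rule min_norm_eqI[OF v(1)])
  fix w assume w: "w \<in> velocities f C (x t)" "norm w \<le> norm v"
  have orth: "(f (x t) - u) \<bullet> v = 0" if "u \<in> velocities f C (x t)" for u
  proof (rule normal_orthogonal_velocity[OF t v(2)])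
    fix s :: real assume "0 \<le> s"
    then show "(f (x t) - u) \<bullet> (x s - x t)
        \<le> norm (f (x t) - u) / (2 * \<rho>) * (norm (x s - x t))\<^sup>2"
      using that by (intro prox_normal_cone_inner_le[OF prox_regular_C \<rho>] solution_in_C)
        (auto simp: velocities_iff)
  qed
  have "(w - v) \<bullet> v = 0"
    using orth[OF w(1)] orth[OF v(1)] by (simp add: inner_diff)
  moreover have "(norm w)\<^sup>2 = (norm v)\<^sup>2 + 2 * ((w - v) \<bullet> v) + (norm (w - v))\<^sup>2"
    by (simp add: power2_norm_eq_inner inner_diff inner_commute algebra_simps)
  moreover have "(norm w)\<^sup>2 \<le> (norm v)\<^sup>2" using w(2) by (intro power_mono) auto
  ultimately show "w = v" by simp
qed

lemma ae_derivative:
  obtains N where "negligible N" "0 \<in> N"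
    "\<And>t. 0 \<le> t \<Longrightarrow> t \<notin> N \<Longrightarrow> (x has_vector_derivative min_velocity (x t)) (at t within {0..})"
proof -
  obtain N where N: "negligible N" "0 \<in> N"
    "\<And>t. 0 \<le> t \<Longrightarrow> t \<notin> N \<Longrightarrow> \<exists>v\<in>velocities f C (x t). (x has_vector_derivative v) (at t within {0..})"
    using ae_velocity by metis
  show ?thesis
  proof (rule that[OF N(1,2)])
    fix t :: real assume t: "0 \<le> t" "t \<notin> N"
    then have "0 < t" using N(2) by (metis order_le_less)
    then show "(x has_vector_derivative min_velocity (x t)) (at t within {0..})"
      using N(3)[OF t] derivative_is_min_velocity by metis
  qed
qed

lemma f_bounded_along_solution:
  obtains B where "0 \<le> B" "\<And>t. t \<in> {0..b} \<Longrightarrow> norm (f (x t)) \<le> B"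
proof -
  have "continuous_on {0..b} (\<lambda>t. f (x t))"
    by (rule continuous_on_compose2[OF lipschitz_on_continuous_on[OF lip_f] continuous_on_solution]) simp
  then have "bounded ((\<lambda>t. f (x t)) ` {0..b})"
    by (intro compact_imp_bounded compact_continuous_image) auto
  then obtain B where "B > 0" "\<forall>y\<in>(\<lambda>t. f (x t)) ` {0..b}. norm y \<le> B"
    using bounded_pos by blast
  then show ?thesis by (intro that[of B]) auto
qed

end

section \<open>One-sided derivatives at every time\<close>

text \<open>
  Since \<open>B\<close> bounds \<open>norm (f (x t))\<close> on \<open>[0, T]\<close>, it also bounds the velocities of minimal norm there, and
  \<open>2 * B\<close> bounds their normal parts. The Gronwall estimates therefore hold with the single
  constant \<open>K\<close>.
\<close>

locale bounded_sweeping_solution = sweeping_solution +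
  fixes T B :: real
  assumes f_le: "\<And>t. 0 \<le> t \<Longrightarrow> t \<le> T \<Longrightarrow> norm (f (x t)) \<le> B" and B_nonneg: "0 \<le> B"
begin

abbreviation (input) K :: real where "K \<equiv> k + 2 * B / \<rho>"

lemma K_nonneg: "0 \<le> K"
  using k_nonneg B_nonneg \<rho> by simp

lemma min_velocity_bounds:
  assumes "0 \<le> t" "t \<le> T"
  shows "min_velocity (x t) \<in> velocities f C (x t)" "norm (min_velocity (x t)) \<le> B"
    "norm (f (x t)) \<le> B"
  using min_velocity_in norm_min_velocity_le_f[of "x t"] solution_in_C f_le assms order_trans by blast+

text \<open>
  Almost everywhere the derivative is the velocity of minimal norm, which is at most as long as the
  velocity \<open>f (x t)\<close> with zero normal part.
\<close>

lemma lipschitz_on_solution: "B-lipschitz_on {0..T} x"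
proof (rule lipschitz_onI)
  obtain N where N: "negligible N"
    "\<And>t. 0 \<le> t \<Longrightarrow> t \<notin> N \<Longrightarrow> (x has_vector_derivative min_velocity (x t)) (at t within {0..})"
    using ae_derivative by metis
  have le: "norm (x v - x u) \<le> B * (v - u)" if "0 \<le> u" "u \<le> v" "v \<le> T" for u v
  proof (rule abs_continuous_norm_increment_le[OF that(2) _ N(1) B_nonneg])
    show "abs_continuous u v x"
      using solution that by (auto simp: is_solution_def loc_abs_continuous_def)
    fix t assume "t \<in> {u..v} - N"
    then show "\<exists>w. norm w \<le> B \<and> (x has_vector_derivative w) (at t within {u..v})"
      using that min_velocity_bounds(2)[of t] N(2)[of t]
      by (intro exI[of _ "min_velocity (x t)"])
        (auto intro: has_vector_derivative_within_subset)
  qed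
  fix s t assume "s \<in> {0..T}" "t \<in> {0..T}"
  then show "dist (x s) (x t) \<le> B * dist s t"
    using le[of s t] le[of t s]
    by (cases "s \<le> t") (auto simp: dist_norm norm_minus_commute)
qed (rule B_nonneg)

text \<open>
  Gronwall for the displacement from \<open>x s\<close>, compared with the stationary point \<open>x s\<close> and its velocity
  of minimal norm.
\<close>

lemma displacement_le:
  assumes s: "0 \<le> s" and h: "0 \<le> h" "s + h \<le> T"
  shows "norm (x (s + h) - x s) \<le> exp (K * h) * (norm (min_velocity (x s)) * h)"
proof -
  define z where "z = min_velocity (x s)"
  obtain N where N: "negligible N"
    "\<And>t. 0 \<le> t \<Longrightarrow> t \<notin> N \<Longrightarrow> (x has_vector_derivative min_velocity (x t)) (at t within {0..})"
    using ae_derivative by metis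
  have "norm (x (s + h) - x s) \<le> exp (K * (s + h - s)) * (norm (x s - x s) + norm z * (s + h - s))"
  proof (rule gronwall_norm[OF _ _ N(1) norm_ge_zero K_nonneg])
    show "B-lipschitz_on {s..s + h} (\<lambda>t. x t - x s)"
      using lipschitz_on_subset[OF lipschitz_on_solution, of "{s..s + h}"] s h
      by (auto simp: lipschitz_on_def dist_norm)
    fix t assume t: "t \<in> {s..s + h} - N"
    define v where "v = min_velocity (x t)"
    have t': "0 \<le> t" "t \<le> T" using t s h by auto
    have s': "s \<le> T" using s h by auto
    have "((\<lambda>t. x t - x s) has_vector_derivative v) (at t within {s..s + h})"
      using has_vector_derivative_within_subset[OF N(2)[of t], of "{s..s + h}"] t s
      by (auto simp: v_def intro!: derivative_eq_intros)
    moreover have "v \<bullet> (x t - x s) \<le> norm z * norm (x t - x s) + K * (norm (x t - x s))\<^sup>2"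
    proof -
      have "(v - z) \<bullet> (x t - x s) \<le> K * (norm (x t - x s))\<^sup>2"
        unfolding v_def z_def
        by (intro velocities_one_sided_lipschitz min_velocity_bounds t' s s')
      moreover have "z \<bullet> (x t - x s) \<le> norm z * norm (x t - x s)" by (rule norm_cauchy_schwarz)
      ultimately show ?thesis by (simp add: inner_diff_left)
    qed
    ultimately show "\<exists>v. ((\<lambda>t. x t - x s) has_vector_derivative v) (at t within {s..s + h}) \<and>
        v \<bullet> (x t - x s) \<le> norm z * norm (x t - x s) + K * (norm (x t - x s))\<^sup>2" by blast
  qed (use h in simp)
  then show ?thesis by (simp add: z_def)
qed

text \<open>
  The error factor of \<open>velocity_near_le\<close> for points at distance at most \<open>d\<close>.
\<close>

definition defect :: "real \<Rightarrow> real" where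
  "defect d = d * (k + 2 * B / \<rho> + B / \<rho> * d + 2 * B)"

lemma defect_mono: "0 \<le> d \<Longrightarrow> d \<le> d' \<Longrightarrow> defect d \<le> defect d'"
  unfolding defect_def using k_nonneg B_nonneg \<rho>
  by (intro mult_mono add_mono) auto

lemma defect_tendsto_0: "((\<lambda>h. defect (B * h)) \<longlongrightarrow> 0) (at_right 0)"
proof -
  have "((\<lambda>h. defect (B * h)) \<longlongrightarrow> defect (B * 0)) (at_right 0)"
    unfolding defect_def by (intro tendsto_intros)
  then show ?thesis by (simp add: defect_def)
qed

lemma velocity_after_le:
  assumes s: "0 \<le> s" and h: "s \<le> t" "t \<le> s + h" "s + h \<le> T" and y: "y \<in> C"
  shows "(f (x s) - min_velocity (x t)) \<bullet> (y - x s)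
    \<le> B / \<rho> * (norm (y - x s))\<^sup>2 + defect (B * h) * (1 + norm (y - x s))"
  unfolding defect_def
proof (rule velocity_near_le)
  show "norm (x t - x s) \<le> B * h"
  proof -
    have "norm (x t - x s) \<le> B * dist t s"
      using lipschitz_onD[OF lipschitz_on_solution, of t s] s h by (simp add: dist_norm)
    also have "\<dots> \<le> B * h" using B_nonneg h by (intro mult_left_mono) (auto simp: dist_real_def)
    finally show ?thesis .
  qed
qed (use min_velocity_bounds[of t] s h y in auto)

text \<open>
  The difference quotient is an average of velocities at times in \<open>[s, s + h]\<close>, and the inequality is
  affine in the velocity. Averaging amounts to bounding the increment of \<open>\<phi>\<close>.
\<close>

lemma difference_quotient_le:
  assumes s: "0 \<le> s" and h: "0 < h" "s + h \<le> T" and y: "y \<in> C"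
  shows "(f (x s) - (x (s + h) - x s) /\<^sub>R h) \<bullet> (y - x s)
    \<le> B / \<rho> * (norm (y - x s))\<^sup>2 + defect (B * h) * (1 + norm (y - x s))" (is "_ \<le> ?M")
proof -
  obtain N where N: "negligible N"
    "\<And>t. 0 \<le> t \<Longrightarrow> t \<notin> N \<Longrightarrow> (x has_vector_derivative min_velocity (x t)) (at t within {0..})"
    using ae_derivative by metis
  \<comment> \<open>Its derivative is the left-hand side of the inequality for the velocity at time \<open>t\<close>.\<close>
  define \<phi> where "\<phi> t = (t *\<^sub>R f (x s) - x t) \<bullet> (y - x s)" for t
  have "\<phi> (s + h) - \<phi> s \<le> ?M * (s + h - s)"
  proof (rule abs_continuous_increment_le[OF _ _ N(1)])
    have "((norm (f (x s)) + B) * norm (y - x s))-lipschitz_on {s..s + h} \<phi>"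
    proof (rule lipschitz_onI)
      fix u v assume uv: "u \<in> {s..s + h}" "v \<in> {s..s + h}"
      have "\<bar>\<phi> u - \<phi> v\<bar> = \<bar>((u - v) *\<^sub>R f (x s) - (x u - x v)) \<bullet> (y - x s)\<bar>"
        by (simp add: \<phi>_def inner_diff algebra_simps)
      also have "\<dots> \<le> norm ((u - v) *\<^sub>R f (x s) - (x u - x v)) * norm (y - x s)"
        by (rule Cauchy_Schwarz_ineq2)
      also have "\<dots> \<le> (dist u v * norm (f (x s)) + B * dist u v) * norm (y - x s)"
      proof (rule mult_right_mono)
        have "norm (x u - x v) \<le> B * dist u v"
          using lipschitz_onD[OF lipschitz_on_solution, of u v] uv s h by (simp add: dist_norm)
        then show "norm ((u - v) *\<^sub>R f (x s) - (x u - x v)) \<le> dist u v * norm (f (x s)) + B * dist u v"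
          using norm_triangle_ineq4[of "(u - v) *\<^sub>R f (x s)" "x u - x v"] by (simp add: dist_real_def)
      qed simp
      finally show "dist (\<phi> u) (\<phi> v) \<le> (norm (f (x s)) + B) * norm (y - x s) * dist u v"
        by (simp add: dist_real_def algebra_simps)
    qed (use B_nonneg in simp)
    then show "abs_continuous s (s + h) \<phi>" by (rule lipschitz_imp_abs_continuous)
    have "0 \<le> defect (B * h)"
      using defect_mono[of 0 "B * h"] B_nonneg h by (simp add: defect_def)
    then show "0 \<le> ?M" using B_nonneg \<rho> by simp
    fix t assume t: "t \<in> {s..s + h} - N"
    have "(x has_derivative (\<lambda>u. u *\<^sub>R min_velocity (x t))) (at t within {s..s + h})"
      using has_vector_derivative_within_subset[OF N(2)[of t], of "{s..s + h}"] t s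
      by (auto simp: has_vector_derivative_def)
    then have "(\<phi> has_real_derivative (f (x s) - min_velocity (x t)) \<bullet> (y - x s)) (at t within {s..s + h})"
      unfolding \<phi>_def has_field_derivative_def
      by (auto intro!: derivative_eq_intros simp: inner_diff algebra_simps fun_eq_iff)
    moreover have "(f (x s) - min_velocity (x t)) \<bullet> (y - x s) \<le> ?M"
      using t s h y by (intro velocity_after_le) auto
    ultimately show "\<exists>D\<le>?M. (\<phi> has_real_derivative D) (at t within {s..s + h})" by blast
  qed (use h in simp)
  moreover have "\<phi> (s + h) - \<phi> s = h * ((f (x s) - (x (s + h) - x s) /\<^sub>R h) \<bullet> (y - x s))"
  proof -
    have "\<phi> (s + h) - \<phi> s = (h *\<^sub>R f (x s) - (x (s + h) - x s)) \<bullet> (y - x s)"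
      by (simp add: \<phi>_def inner_diff algebra_simps)
    also have "h *\<^sub>R f (x s) - (x (s + h) - x s) = h *\<^sub>R (f (x s) - (x (s + h) - x s) /\<^sub>R h)"
      using h by (simp add: scaleR_diff_right)
    finally show ?thesis by (simp only: inner_scaleR_left)
  qed
  ultimately have "h * ((f (x s) - (x (s + h) - x s) /\<^sub>R h) \<bullet> (y - x s)) \<le> h * ?M"
    by (simp add: mult.commute)
  then show ?thesis using h by (subst (asm) mult_le_cancel_left_pos) auto
qed

lemma normal_part_le:
  assumes "0 \<le> s" "s \<le> T"
  shows "norm (f (x s) - min_velocity (x s)) / (2 * \<rho>) \<le> B / \<rho>"
proof -
  have "norm (f (x s) - min_velocity (x s)) \<le> 2 * B"
    using norm_triangle_ineq4[of "f (x s)" "min_velocity (x s)"] min_velocity_bounds[OF assms] by simp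
  then show ?thesis using \<rho> by (simp add: field_simps)
qed

lemma exp_factor_tendsto: "((\<lambda>h. exp (K * h) * c) \<longlongrightarrow> c) (at_right 0)"
proof -
  have "((\<lambda>h. exp (K * h) * c) \<longlongrightarrow> exp (K * 0) * c) (at_right 0)"
    by (intro tendsto_intros)
  then show ?thesis by simp
qed

text \<open>
  The displacement bound and the averaged inequality are the two hypotheses of the convergence
  principle.
\<close>

lemma right_derivative_solution:
  assumes s: "0 \<le> s" "s < T"
  shows "has_right_deriv x (min_velocity (x s)) s"
  unfolding has_right_deriv_def
proof (rule tendsto_min_velocity)
  have near: "\<forall>\<^sub>F h in at_right 0. 0 < h \<and> s + h \<le> T"
    using s by (intro eventually_at_rightI[of 0 "T - s"]) auto
  show "\<forall>\<^sub>F h in at_right 0. norm ((x (s + h) - x s) /\<^sub>R h) \<le> exp (K * h) * norm (min_velocity (x s))"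
    using near
  proof eventually_elim
    case (elim h)
    have "norm ((x (s + h) - x s) /\<^sub>R h) = norm (x (s + h) - x s) / h"
      using elim by (simp add: divide_inverse)
    also have "\<dots> \<le> exp (K * h) * norm (min_velocity (x s))"
      using displacement_le[of s h] s elim by (subst pos_divide_le_eq) (auto simp: mult.assoc)
    finally show ?case .
  qed
  show "\<forall>\<^sub>F h in at_right 0. \<forall>y\<in>C. (f (x s) - (x (s + h) - x s) /\<^sub>R h) \<bullet> (y - x s)
      \<le> B / \<rho> * (norm (y - x s))\<^sup>2 + defect (B * h) * (1 + norm (y - x s))"
    using near
  proof eventually_elim
    case (elim h)
    then show ?case using difference_quotient_le s by blast
  qed
qed (use s solution_in_C exp_factor_tendsto defect_tendsto_0 normal_part_le in auto)

text \<open>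
  Apply Gronwall to the distance between the solution and its time shift, then divide by the shift
  \<open>h\<close> and let it tend to \<open>0\<close>.
\<close>

lemma norm_min_velocity_growth:
  assumes s: "0 \<le> s" "s \<le> t" "t < T"
  shows "norm (min_velocity (x t)) \<le> exp (K * (t - s)) * norm (min_velocity (x s))"
proof -
  obtain N where N: "negligible N"
    "\<And>t. 0 \<le> t \<Longrightarrow> t \<notin> N \<Longrightarrow> (x has_vector_derivative min_velocity (x t)) (at t within {0..})"
    using ae_derivative by metis
  have shift: "norm (x (t + h) - x t) \<le> exp (K * (t - s)) * norm (x (s + h) - x s)"
    if h: "0 < h" "t + h \<le> T" for h
  proof -
    \<comment> \<open>The shifted curve is differentiable at \<open>u\<close> only if \<open>u + h \<notin> N\<close>.\<close>
    define N' where "N' = N \<union> (+) (- h) ` N"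
    have N': "negligible N'"
      unfolding N'_def using N(1) by (intro negligible_Un negligible_translation)
    have "norm (x (t + h) - x t) \<le> exp (K * (t - s)) * (norm (x (s + h) - x s) + 0 * (t - s))"
    proof (rule gronwall_norm[OF s(2) _ N' order_refl K_nonneg])
      show "(B + B)-lipschitz_on {s..t} (\<lambda>u. x (u + h) - x u)"
      proof (rule lipschitz_onI)
        fix u v assume uv: "u \<in> {s..t}" "v \<in> {s..t}"
        have "norm (x (u + h) - x (v + h)) \<le> B * dist u v"
          using lipschitz_onD[OF lipschitz_on_solution, of "u + h" "v + h"] uv s h
          by (simp add: dist_norm)
        moreover have "norm (x u - x v) \<le> B * dist u v"
          using lipschitz_onD[OF lipschitz_on_solution, of u v] uv s h by (simp add: dist_norm)
        ultimately have "norm ((x (u + h) - x (v + h)) - (x u - x v)) \<le> (B + B) * dist u v"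
          using norm_triangle_ineq4[of "x (u + h) - x (v + h)" "x u - x v"] by (simp add: distrib_right)
        then show "dist (x (u + h) - x u) (x (v + h) - x v) \<le> (B + B) * dist u v"
          by (simp add: dist_norm algebra_simps)
      qed (use B_nonneg in simp)
      fix u assume u: "u \<in> {s..t} - N'"
      define v w where "v = min_velocity (x (u + h))" and "w = min_velocity (x u)"
      have u': "0 \<le> u" "u \<le> T" "0 \<le> u + h" "u + h \<le> T" using u s h by auto
      have uN: "u \<notin> N" "u + h \<notin> N"
        using u by (auto simp: N'_def image_iff algebra_simps)
      have "(x has_vector_derivative v) (at (u + h) within {0..})"
        unfolding v_def by (rule N(2)) (use u' uN in auto)
      then have "(x has_vector_derivative v) (at (u + h) within (\<lambda>u. u + h) ` {s..t})"
        by (rule has_vector_derivative_within_subset) (use s h in auto)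
      moreover have "((\<lambda>u. u + h) has_vector_derivative 1) (at u within {s..t})"
        by (auto intro!: derivative_eq_intros)
      ultimately have "((\<lambda>u. x (u + h)) has_vector_derivative v) (at u within {s..t})"
        using vector_diff_chain_within[of "\<lambda>u. u + h" 1 u "{s..t}" x v] by (simp add: o_def)
      moreover have "(x has_vector_derivative w) (at u within {s..t})"
        unfolding w_def by (rule has_vector_derivative_within_subset[OF N(2)]) (use s u' uN in auto)
      ultimately have "((\<lambda>u. x (u + h) - x u) has_vector_derivative v - w) (at u within {s..t})"
        by (rule has_vector_derivative_diff)
      moreover have "(v - w) \<bullet> (x (u + h) - x u) \<le> K * (norm (x (u + h) - x u))\<^sup>2"
        unfolding v_def w_def
        by (intro velocities_one_sided_lipschitz min_velocity_bounds u')
      ultimately show "\<exists>v. ((\<lambda>u. x (u + h) - x u) has_vector_derivative v) (at u within {s..t}) \<and>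
          v \<bullet> (x (u + h) - x u) \<le> 0 * norm (x (u + h) - x u) + K * (norm (x (u + h) - x u))\<^sup>2"
        by auto
    qed
    then show ?thesis by simp
  qed
  have "\<forall>\<^sub>F h in at_right 0. norm ((x (t + h) - x t) /\<^sub>R h)
      \<le> exp (K * (t - s)) * norm ((x (s + h) - x s) /\<^sub>R h)"
  proof (rule eventually_at_rightI[of 0 "T - t"])
    fix h assume "h \<in> {0<..<T - t}"
    then have h: "0 < h" "t + h \<le> T" by auto
    have scale: "norm ((x (u + h) - x u) /\<^sub>R h) = norm (x (u + h) - x u) / h" for u
      using h by (simp add: divide_inverse)
    show "norm ((x (t + h) - x t) /\<^sub>R h) \<le> exp (K * (t - s)) * norm ((x (s + h) - x s) /\<^sub>R h)"
      using divide_right_mono[OF shift[OF h], of h] h unfolding scale by simp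
  qed (use s in simp)
  moreover have "((\<lambda>h. norm ((x (t + h) - x t) /\<^sub>R h)) \<longlongrightarrow> norm (min_velocity (x t))) (at_right 0)"
    using right_derivative_solution[of t] s by (intro tendsto_norm) (simp add: has_right_deriv_def)
  moreover have "((\<lambda>h. exp (K * (t - s)) * norm ((x (s + h) - x s) /\<^sub>R h))
      \<longlongrightarrow> exp (K * (t - s)) * norm (min_velocity (x s))) (at_right 0)"
    using right_derivative_solution[of s] s by (intro tendsto_mult_left tendsto_norm) (simp add: has_right_deriv_def)
  ultimately show ?thesis by (intro tendsto_le[of "at_right (0::real)"]) auto
qed

text \<open>
  The exponential growth bound prevents the minimal norms from jumping up to the right of \<open>s\<close>, which
  is all that the convergence principle requires besides the approximate inequalities.
\<close>

lemma min_velocity_right_continuous: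
  assumes s: "0 \<le> s" "s < T"
  shows "((\<lambda>h. min_velocity (x (s + h))) \<longlongrightarrow> min_velocity (x s)) (at_right 0)"
proof (rule tendsto_min_velocity)
  have near: "\<forall>\<^sub>F h in at_right 0. 0 < h \<and> s + h < T"
    using s by (intro eventually_at_rightI[of 0 "T - s"]) auto
  show "\<forall>\<^sub>F h in at_right 0. norm (min_velocity (x (s + h))) \<le> exp (K * h) * norm (min_velocity (x s))"
    using near
  proof eventually_elim
    case (elim h)
    then show ?case using norm_min_velocity_growth[of s "s + h"] s by simp
  qed
  show "\<forall>\<^sub>F h in at_right 0. \<forall>y\<in>C. (f (x s) - min_velocity (x (s + h))) \<bullet> (y - x s)
      \<le> B / \<rho> * (norm (y - x s))\<^sup>2 + defect (B * h) * (1 + norm (y - x s))"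
    using near
  proof eventually_elim
    case (elim h)
    then show ?case using velocity_after_le[of s "s + h" h] s by simp
  qed
qed (use s solution_in_C exp_factor_tendsto defect_tendsto_0 normal_part_le in auto)

end

section \<open>The right derivative of the solution\<close>

lemma right_deriv_eqI:
  assumes "has_right_deriv x v t"
  shows "right_deriv x t = v"
  unfolding right_deriv_def
proof (rule the_equality[where P = "\<lambda>v. has_right_deriv x v t", OF assms])
  show "w = v" if "has_right_deriv x w t" for w
    using tendsto_unique[of "at_right (0::real)"] that assms by (auto simp: has_right_deriv_def)
qed

theorem theorem3p2:
  fixes C :: "'a::{real_inner, complete_space} set"
    and r :: ereal and k :: real
    and f :: "'a \<Rightarrow> 'a" and x0 :: 'a and x :: "real \<Rightarrow> 'a"
  assumes "C \<noteq> {}" and "closed C"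
    and "0 < r" and "prox_regular r C"
    and "k-lipschitz_on UNIV f"
    and "x0 \<in> C"
    and "is_solution f C x0 x"
  shows "(AE t in lebesgue_on {0..}.
            (x has_vector_derivative min_norm (velocities f C (x t))) (at t within {0..})) \<and>
         (\<forall>t\<ge>0. has_right_deriv x (min_norm (velocities f C (x t))) t \<and>
                right_deriv x t = min_norm (velocities f C (x t))) \<and>
         (\<forall>t\<ge>0. continuous (at_right t) (right_deriv x))"
proof -
  obtain \<rho> :: real where \<rho>: "0 < \<rho>" "ereal \<rho> < r"
    using ereal_dense2[OF \<open>0 < r\<close>] by (auto simp: zero_ereal_def)
  interpret sweeping_solution C r \<rho> k f x x0
    by unfold_locales (use assms \<rho> in auto)
  have ae: "AE t in lebesgue_on {0..}. (x has_vector_derivative min_velocity (x t)) (at t within {0..})"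
    unfolding AE_lebesgue_on_Ici_iff using ae_derivative by metis
  have local_bound: "\<exists>B. bounded_sweeping_solution C r \<rho> k f x x0 (t + 1) B" if "0 \<le> t" for t
  proof -
    obtain B where "0 \<le> B" "\<And>s. s \<in> {0..t + 1} \<Longrightarrow> norm (f (x s)) \<le> B"
      using f_bounded_along_solution[of "t + 1"] by blast
    then have "bounded_sweeping_solution C r \<rho> k f x x0 (t + 1) B"
      by unfold_locales auto
    then show ?thesis by blast
  qed
  have deriv: "has_right_deriv x (min_velocity (x t)) t" if t: "0 \<le> t" for t
  proof -
    obtain B where "bounded_sweeping_solution C r \<rho> k f x x0 (t + 1) B" using local_bound[OF t] by blast
    then interpret bounded_sweeping_solution C r \<rho> k f x x0 "t + 1" B .
    show ?thesis using right_derivative_solution t by simp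
  qed
  have right: "right_deriv x t = min_velocity (x t)" if "0 \<le> t" for t
    using right_deriv_eqI[OF deriv[OF that]] .
  have "continuous (at_right t) (right_deriv x)" if t: "0 \<le> t" for t
  proof -
    obtain B where "bounded_sweeping_solution C r \<rho> k f x x0 (t + 1) B" using local_bound[OF t] by blast
    then interpret bounded_sweeping_solution C r \<rho> k f x x0 "t + 1" B .
    have "((\<lambda>h. min_velocity (x (t + h))) \<longlongrightarrow> right_deriv x t) (at_right 0)"
      using min_velocity_right_continuous[of t] t right by simp
    moreover have "\<forall>\<^sub>F h in at_right 0. min_velocity (x (t + h)) = right_deriv x (t + h)"
      using eventually_at_right_less[of "0::real"] by eventually_elim (use t right in simp)
    ultimately have "((\<lambda>h. right_deriv x (t + h)) \<longlongrightarrow> right_deriv x t) (at_right 0)"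
      by (rule Lim_transform_eventually)
    then show ?thesis
      unfolding continuous_within filterlim_at_right_to_0[of _ _ t] by (simp add: add.commute)
  qed
  then show ?thesis using ae deriv right by blast
qed

end
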